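(* Let $\theta$ be an inner function and $\varphi\in L^\infty$. The map $$\mathcal N_D\colon \ker D_\varphi^\theta\to\ker (D_\varphi^\theta)^*,\qquad \mathcal N_D(f_-+\theta\tilde f_+)=\overline{z\tilde f_+}+\theta\,\overline{zf_-},\quad f_-\in H^2_-,\ \tilde f_+\in H^2,$$ is a (conjugate-linear) isomorphism, and $$\ker (D_\varphi^\theta)^*=C_\theta(\ker D_\varphi^\theta).$$
   Context: $L^2=L^2(\mathbb T)$, $L^\infty=L^\infty(\mathbb T)$, $\mathbb T$ the unit circle; $H^2$ is the Hardy space of the unit disk viewed as a subspace of $L^2$, and $H^2_-=\bar z\,\overline{H^2}=L^2\ominus H^2$. For an inner function $\theta$, $K_\theta=H^2\ominus\theta H^2$, $(K_\theta)^\perp=L^2\ominus K_\theta=H^2_-\oplus\theta H^2$, and $Q_\theta$ is the orthogonal projection of $L^2$ onto $(K_\theta)^\perp$. For $\varphi\in L^\infty$, $D_\varphi^\theta\colon (K_\theta)^\perp\to(K_\theta)^\perp$ is the dual truncated Toeplitz operator $D_\varphi^\theta f=Q_\theta(\varphi f)$. $C_\theta\colon L^2\to L^2$ is the conjugation $C_\theta f=\theta\bar z\bar f$. *)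

theory Defs
  imports "HOL-Complex_Analysis.Complex_Analysis"
begin

section \<open>Measurable functions on the unit circle modulo null sets\<close>

text \<open>Normalised arc length, as a measure whose space is exactly the unit circle.\<close>

definition circle_measure :: "complex measure" where
  "circle_measure =
     distr (uniform_measure lborel {0..2*pi}) (restrict_space borel (sphere 0 1)) cis"

lemma sets_circle_measure [measurable_cong]:
  "sets circle_measure = sets (restrict_space borel (sphere 0 1))"
  by (simp add: circle_measure_def)

lemma borel_measurable_cnj' [measurable (raw)]:
  "f \<in> borel_measurable M \<Longrightarrow> (\<lambda>x. cnj (f x)) \<in> borel_measurable M"
  by (rule borel_measurable_continuous_on[of cnj]) (auto intro: continuous_intros)

definition circle_eq :: "(complex \<Rightarrow> complex) \<Rightarrow> (complex \<Rightarrow> complex) \<Rightarrow> bool" where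
  "circle_eq f g \<longleftrightarrow> f \<in> borel_measurable circle_measure \<and> g \<in> borel_measurable circle_measure \<and>
     (AE z in circle_measure. f z = g z)"

text \<open>
  The ambient algebra: almost-everywhere classes of measurable functions on the circle.
  The spaces L2, L-infinity and H2 are subsets of this one type, so that products such as
  a bounded function times a square-integrable one are ordinary products.
\<close>

quotient_type circle_fun = "complex \<Rightarrow> complex" / partial: circle_eq
proof (rule part_equivpI)
  show "\<exists>f. circle_eq f f"
    by (rule exI[of _ "\<lambda>_. 0"]) (simp add: circle_eq_def)
  show "symp circle_eq"
    by (rule sympI) (auto simp: circle_eq_def elim: AE_mp)
  show "transp circle_eq"
    by (rule transpI) (auto simp: circle_eq_def elim: AE_mp)
qed

instantiation circle_fun :: comm_ring
begin

lift_definition zero_circle_fun :: circle_fun is "\<lambda>_. 0"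
  by (simp add: circle_eq_def)

lift_definition plus_circle_fun :: "circle_fun \<Rightarrow> circle_fun \<Rightarrow> circle_fun"
  is "\<lambda>f g z. f z + g z"
  unfolding circle_eq_def by (auto elim: AE_mp)

lift_definition minus_circle_fun :: "circle_fun \<Rightarrow> circle_fun \<Rightarrow> circle_fun"
  is "\<lambda>f g z. f z - g z"
  unfolding circle_eq_def by (auto elim: AE_mp)

lift_definition uminus_circle_fun :: "circle_fun \<Rightarrow> circle_fun"
  is "\<lambda>f z. - f z"
  unfolding circle_eq_def by (auto elim: AE_mp)

lift_definition times_circle_fun :: "circle_fun \<Rightarrow> circle_fun \<Rightarrow> circle_fun"
  is "\<lambda>f g z. f z * g z"
  unfolding circle_eq_def by (auto elim: AE_mp)

instance
  by standard (transfer; simp add: circle_eq_def algebra_simps)+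

end

lift_definition circle_const :: "complex \<Rightarrow> circle_fun" is "\<lambda>c _. c"
  by (simp add: circle_eq_def)

lift_definition circle_cnj :: "circle_fun \<Rightarrow> circle_fun" is "\<lambda>f z. cnj (f z)"
  unfolding circle_eq_def by (auto elim: AE_mp)

text \<open>The coordinate function \<open>z\<close>.\<close>

lift_definition circle_z :: circle_fun is "\<lambda>z. z"
  by (simp add: circle_eq_def measurable_cong_sets[OF sets_circle_measure refl]
      measurable_restrict_space1)


section \<open>Lebesgue spaces\<close>

lift_definition square_integrable :: "circle_fun \<Rightarrow> bool"
  is "\<lambda>f. integrable circle_measure (\<lambda>z. (cmod (f z))\<^sup>2)"
  unfolding circle_eq_def by (rule integrable_cong_AE) (auto elim: AE_mp)

lift_definition essentially_bounded :: "circle_fun \<Rightarrow> bool"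
  is "\<lambda>f. \<exists>C. AE z in circle_measure. cmod (f z) \<le> C"
  unfolding circle_eq_def by (intro iff_exI) (auto elim: AE_mp)

lift_definition unimodular :: "circle_fun \<Rightarrow> bool"
  is "\<lambda>f. AE z in circle_measure. cmod (f z) = 1"
  unfolding circle_eq_def by (auto elim: AE_mp)

definition L2 :: "circle_fun set" where
  "L2 = {f. square_integrable f}"

definition Linf :: "circle_fun set" where
  "Linf = {f. essentially_bounded f}"

lift_definition L2_inner :: "circle_fun \<Rightarrow> circle_fun \<Rightarrow> complex"
  is "\<lambda>f g. \<integral>z. f z * cnj (g z) \<partial>circle_measure"
  unfolding circle_eq_def by (rule integral_cong_AE) (auto elim: AE_mp)

lift_definition L2_norm :: "circle_fun \<Rightarrow> real"
  is "\<lambda>f. sqrt (\<integral>z. (cmod (f z))\<^sup>2 \<partial>circle_measure)"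
  unfolding circle_eq_def by (rule arg_cong[of _ _ sqrt], rule integral_cong_AE) (auto elim: AE_mp)

definition ominus :: "circle_fun set \<Rightarrow> circle_fun set \<Rightarrow> circle_fun set" (infixl "\<ominus>\<^sub>L" 65) where
  "M \<ominus>\<^sub>L N = {f \<in> M. \<forall>g\<in>N. L2_inner f g = 0}"

definition orth_proj :: "circle_fun set \<Rightarrow> circle_fun \<Rightarrow> circle_fun" where
  "orth_proj M f = (THE g. g \<in> M \<and> (\<forall>h\<in>M. L2_inner (f - g) h = 0))"


section \<open>Hardy spaces and inner functions\<close>

lemma measurable_dilation:
  assumes "F holomorphic_on ball 0 1" "0 < r" "r < (1::real)"
  shows "(\<lambda>z. F (of_real r * z)) \<in> borel_measurable circle_measure"
proof -
  have "continuous_on (sphere 0 1) (\<lambda>z. F (of_real r * z))"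
    by (rule continuous_on_compose2[OF holomorphic_on_imp_continuous_on[OF assms(1)]])
      (use assms in \<open>auto intro!: continuous_intros simp: norm_mult\<close>)
  then show ?thesis
    by (simp add: measurable_cong_sets[OF sets_circle_measure refl]
        borel_measurable_continuous_on_restrict)
qed

text \<open>
  \<open>f\<close> is the boundary function of the holomorphic function \<open>F\<close>: the dilations \<open>z \<mapsto> F (r z)\<close>
  converge to \<open>f\<close> in L2 as \<open>r\<close> increases to 1. For \<open>F\<close> in the Hardy space of the disk, this is
  the function of nontangential boundary values. Holomorphy is part of the condition so that the
  dilations are measurable; square integrability of the limit is required in
  \<open>boundary_function\<close>, so that the integrals below are not those of a non-integrable function.
\<close>

lift_definition L2_dilation_limit :: "(complex \<Rightarrow> complex) \<Rightarrow> circle_fun \<Rightarrow> bool"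
  is "\<lambda>F f. F holomorphic_on ball 0 1 \<and>
     ((\<lambda>r. \<integral>z. (cmod (F (of_real r * z) - f z))\<^sup>2 \<partial>circle_measure) \<longlongrightarrow> 0) (at_left 1)"
proof (rule conj_cong[OF refl], rule filterlim_cong[OF refl refl])
  fix F f g :: "complex \<Rightarrow> complex"
  assume fg: "circle_eq f g" and F: "F holomorphic_on ball 0 1"
  have "eventually (\<lambda>r::real. r \<in> {0<..<1}) (at_left 1)"
    by (rule eventually_at_left_real) simp
  then show "\<forall>\<^sub>F r in at_left 1.
      (\<integral>z. (cmod (F (of_real r * z) - f z))\<^sup>2 \<partial>circle_measure) =
      (\<integral>z. (cmod (F (of_real r * z) - g z))\<^sup>2 \<partial>circle_measure)"
  proof eventually_elim
    case (elim r)
    then have [measurable]: "(\<lambda>z. F (of_real r * z)) \<in> borel_measurable circle_measure"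
      using measurable_dilation[OF F] by simp
    from fg have [measurable]: "f \<in> borel_measurable circle_measure"
      "g \<in> borel_measurable circle_measure" and "AE z in circle_measure. f z = g z"
      by (auto simp: circle_eq_def)
    then show ?case
      by (intro integral_cong_AE) auto
  qed
qed

definition boundary_function :: "(complex \<Rightarrow> complex) \<Rightarrow> circle_fun \<Rightarrow> bool" where
  "boundary_function F f \<longleftrightarrow> f \<in> L2 \<and> L2_dilation_limit F f"

definition hardy_disk :: "(complex \<Rightarrow> complex) set" where
  "hardy_disk = {F. F holomorphic_on ball 0 1 \<and>
     (\<exists>C. \<forall>r\<in>{0..<1}. (\<integral>z. (cmod (F (of_real r * z)))\<^sup>2 \<partial>circle_measure) \<le> C)}"

definition H2 :: "circle_fun set" where
  "H2 = {f. \<exists>F\<in>hardy_disk. boundary_function F f}"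

definition H2_minus :: "circle_fun set" where
  "H2_minus = (\<lambda>f. circle_cnj circle_z * circle_cnj f) ` H2"

definition inner_function :: "circle_fun \<Rightarrow> bool" where
  "inner_function \<theta> \<longleftrightarrow>
     (\<exists>F. F holomorphic_on ball 0 1 \<and> bounded (F ` ball 0 1) \<and> boundary_function F \<theta>) \<and>
     unimodular \<theta>"


section \<open>Dual truncated Toeplitz operators\<close>

definition model_space :: "circle_fun \<Rightarrow> circle_fun set" where
  "model_space \<theta> = H2 \<ominus>\<^sub>L (\<lambda>h. \<theta> * h) ` H2"

definition model_perp :: "circle_fun \<Rightarrow> circle_fun set" where
  "model_perp \<theta> = L2 \<ominus>\<^sub>L model_space \<theta>"

text \<open>An operator on \<open>model_perp \<theta>\<close>; its values elsewhere are irrelevant.\<close>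

definition dual_toeplitz :: "circle_fun \<Rightarrow> circle_fun \<Rightarrow> circle_fun \<Rightarrow> circle_fun" where
  "dual_toeplitz \<theta> \<phi> f = orth_proj (model_perp \<theta>) (\<phi> * f)"

text \<open>Hilbert space adjoint and kernel of an operator \<open>T : M \<rightarrow> M\<close> on a closed subspace \<open>M\<close> of L2.\<close>

definition adjoint_on :: "circle_fun set \<Rightarrow> (circle_fun \<Rightarrow> circle_fun) \<Rightarrow> circle_fun \<Rightarrow> circle_fun" where
  "adjoint_on M T g = (THE h. h \<in> M \<and> (\<forall>f\<in>M. L2_inner (T f) g = L2_inner f h))"

definition ker_on :: "circle_fun set \<Rightarrow> (circle_fun \<Rightarrow> circle_fun) \<Rightarrow> circle_fun set" where
  "ker_on M T = {f \<in> M. T f = 0}"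

definition C_conj :: "circle_fun \<Rightarrow> circle_fun \<Rightarrow> circle_fun" where
  "C_conj \<theta> f = \<theta> * circle_cnj circle_z * circle_cnj f"

definition N_D :: "circle_fun \<Rightarrow> circle_fun \<Rightarrow> circle_fun" where
  "N_D \<theta> f = (THE h. \<exists>f_minus\<in>H2_minus. \<exists>f_plus\<in>H2. f = f_minus + \<theta> * f_plus \<and>
     h = circle_cnj (circle_z * f_plus) + \<theta> * circle_cnj (circle_z * f_minus))"

text \<open>
  Conjugate-linear isomorphism of subspaces of L2: a conjugate-linear bijection, bounded
  together with its inverse.
\<close>

definition conj_linear_iso ::
  "(circle_fun \<Rightarrow> circle_fun) \<Rightarrow> circle_fun set \<Rightarrow> circle_fun set \<Rightarrow> bool" where
  "conj_linear_iso T M N \<longleftrightarrow>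
     bij_betw T M N \<and>
     (\<forall>f\<in>M. \<forall>g\<in>M. T (f + g) = T f + T g) \<and>
     (\<forall>c. \<forall>f\<in>M. T (circle_const c * f) = circle_const (cnj c) * T f) \<and>
     (\<exists>C. \<forall>f\<in>M. L2_norm (T f) \<le> C * L2_norm f) \<and>
     (\<exists>C. \<forall>f\<in>M. L2_norm f \<le> C * L2_norm (T f))"

end

theory Submission
  imports Defs
begin

text \<open>
  On the complement \<open>M\<close> of the model space, \<open>N_D \<theta>\<close> is
  nothing but the conjugation \<open>C_conj \<theta>\<close>: since \<open>\<theta>\<close>
  is unimodular, applying \<open>C_conj \<theta>\<close> to \<open>f\<^sub>- + \<theta>
  f\<^sub>+\<close> gives the defining formula of \<open>N_D\<close>
  (\<open>C_conj_on_decomposition\<close>). The conjugation is an antiunitary involution of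
  L2 which maps \<open>M\<close> to itself and intertwines multiplication by
  \<open>\<phi>\<close> with multiplication by its conjugate. A function \<open>f \<in>
  M\<close> lies in the kernel of \<open>dual_toeplitz \<theta> \<phi>\<close> if and only
  if \<open>\<phi> f\<close> is orthogonal to \<open>M\<close>, and the adjoint is the
  operator with the conjugate symbol. Hence \<open>C_conj \<theta>\<close> exchanges the two
  kernels (\<open>C_conj_ker\<close>), and all claims about \<open>N_D\<close> are
  properties of an isometric conjugate-linear involution.

  All of this rests on the splitting \<open>M = H2_minus + \<theta> H2\<close>
  (\<open>model_perp_decomposition\<close>), which also provides the orthogonal projection
  onto \<open>M\<close> explicitly. It follows from three facts: \<open>H2\<close> and
  \<open>H2_minus\<close> are orthogonal, they span L2, and \<open>\<theta> H2 \<subseteq>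
  H2\<close>. The analytic work is to derive these facts from the definition of
  \<open>H2\<close> by L2 limits of dilations. The bridge is \<open>H2_iff\<close>: an L2
  function belongs to \<open>H2\<close> exactly when its Fourier coefficients of negative
  index vanish. One direction is Cauchy's theorem applied to the dilations. The other one
  needs the Riesz-Fischer construction of an \<open>H2\<close> function with prescribed
  square-summable coefficients (\<open>hardy_function_of_coefficients\<close>) and the fact
  that an L2 function all of whose Fourier coefficients vanish is zero
  (\<open>fourier_null_AE_zero\<close>).
\<close>

section \<open>Square-integrable functions on a measure space\<close>

definition sq_int :: "'a measure \<Rightarrow> ('a \<Rightarrow> complex) \<Rightarrow> bool" where
  "sq_int M f \<longleftrightarrow> f \<in> borel_measurable M \<and> integrable M (\<lambda>x. (cmod (f x))\<^sup>2)"

lemma sq_int_measurable [measurable_dest]: "sq_int M f \<Longrightarrow> f \<in> borel_measurable M"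
  and sq_int_integrable: "sq_int M f \<Longrightarrow> integrable M (\<lambda>x. (cmod (f x))\<^sup>2)"
  by (auto simp: sq_int_def)

lemma integrable_mult_sq_int:
  assumes "sq_int M f" "sq_int M g"
  shows "integrable M (\<lambda>x. f x * g x)"
proof (rule Bochner_Integration.integrable_bound)
  note [measurable] = sq_int_measurable[OF assms(1)] sq_int_measurable[OF assms(2)]
  show "integrable M (\<lambda>x. (cmod (f x))\<^sup>2 + (cmod (g x))\<^sup>2)"
    using assms by (auto simp: sq_int_def)
  show "(\<lambda>x. f x * g x) \<in> borel_measurable M"
    by measurable
  have "cmod a * cmod b \<le> (cmod a)\<^sup>2 + (cmod b)\<^sup>2" for a b
    using sum_squares_bound[of "cmod a" "cmod b"] mult_nonneg_nonneg[of "cmod a" "cmod b"]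
    by (simp del: mult_nonneg_nonneg)
  then show "AE x in M. norm (f x * g x) \<le> norm ((cmod (f x))\<^sup>2 + (cmod (g x))\<^sup>2)"
    by (simp add: norm_mult)
qed

lemma sq_int_cmult:
  assumes "sq_int M f" shows "sq_int M (\<lambda>x. c * f x)"
  using assms by (auto simp: sq_int_def norm_mult power_mult_distrib)

lemma sq_int_cnj: "sq_int M f \<Longrightarrow> sq_int M (\<lambda>x. cnj (f x))"
  by (auto simp: sq_int_def)

lemma sq_int_bounded_mult:
  assumes f: "sq_int M f" and [measurable]: "u \<in> borel_measurable M"
    and C: "AE x in M. cmod (u x) \<le> C"
  shows "sq_int M (\<lambda>x. u x * f x)"
  unfolding sq_int_def
proof
  note [measurable] = sq_int_measurable[OF f]
  show "(\<lambda>x. u x * f x) \<in> borel_measurable M" by measurable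
  show "integrable M (\<lambda>x. (cmod (u x * f x))\<^sup>2)"
  proof (rule Bochner_Integration.integrable_bound)
    show "integrable M (\<lambda>x. C\<^sup>2 * (cmod (f x))\<^sup>2)" using f by (simp add: sq_int_def)
    show "AE x in M. norm ((cmod (u x * f x))\<^sup>2) \<le> norm (C\<^sup>2 * (cmod (f x))\<^sup>2)"
      using C by eventually_elim
        (auto simp: norm_mult power_mult_distrib intro!: mult_right_mono power_mono)
  qed measurable
qed

lemma sq_int_add:
  assumes "sq_int M f" "sq_int M g"
  shows "sq_int M (\<lambda>x. f x + g x)"
  unfolding sq_int_def
proof
  note [measurable] = sq_int_measurable[OF assms(1)] sq_int_measurable[OF assms(2)]
  show "(\<lambda>x. f x + g x) \<in> borel_measurable M" by measurable
  show "integrable M (\<lambda>x. (cmod (f x + g x))\<^sup>2)"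
  proof (rule Bochner_Integration.integrable_bound)
    show "integrable M (\<lambda>x. 2 * (cmod (f x))\<^sup>2 + 2 * (cmod (g x))\<^sup>2)"
      using assms by (auto simp: sq_int_def)
    have "(cmod (a + b))\<^sup>2 \<le> 2 * (cmod a)\<^sup>2 + 2 * (cmod b)\<^sup>2" for a b :: complex
    proof -
      have "(cmod (a + b))\<^sup>2 \<le> (cmod a + cmod b)\<^sup>2"
        by (intro power_mono norm_triangle_ineq) simp
      also have "\<dots> \<le> 2 * (cmod a)\<^sup>2 + 2 * (cmod b)\<^sup>2"
        using sum_squares_bound[of "cmod a" "cmod b"] by (simp add: power2_sum)
      finally show ?thesis .
    qed
    then show "AE x in M. norm ((cmod (f x + g x))\<^sup>2) \<le> norm (2 * (cmod (f x))\<^sup>2 + 2 * (cmod (g x))\<^sup>2)"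
      by auto
  qed measurable
qed

lemma sq_int_diff:
  assumes "sq_int M f" "sq_int M g"
  shows "sq_int M (\<lambda>x. f x - g x)"
  using sq_int_add[OF assms(1) sq_int_cmult[OF assms(2), of "-1"]] by simp

text \<open>
  The quadratic polynomial \<open>t \<mapsto> \<integral> (t |f| - |g|)\<^sup>2\<close> is
  nonnegative; evaluated at its minimum it gives the inequality. If \<open>f\<close>
  vanishes almost everywhere, it is linear instead.
\<close>

lemma integral_Cauchy_Schwarz:
  assumes f: "sq_int M f" and g: "sq_int M g"
  shows "(\<integral>x. cmod (f x * g x) \<partial>M) \<le> sqrt (\<integral>x. (cmod (f x))\<^sup>2 \<partial>M) * sqrt (\<integral>x. (cmod (g x))\<^sup>2 \<partial>M)"
proof -
  define A B C where "A = (\<integral>x. (cmod (f x))\<^sup>2 \<partial>M)" and "B = (\<integral>x. (cmod (g x))\<^sup>2 \<partial>M)"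
    and "C = (\<integral>x. cmod (f x * g x) \<partial>M)"
  have pos: "A \<ge> 0" "B \<ge> 0" "C \<ge> 0" by (simp_all add: A_def B_def C_def)
  have fg: "integrable M (\<lambda>x. cmod (f x * g x))"
    by (intro integrable_norm integrable_mult_sq_int f g)
  note int = sq_int_integrable[OF f] sq_int_integrable[OF g]
  have q: "0 \<le> t\<^sup>2 * A - 2 * t * C + B" for t :: real
  proof -
    have "0 \<le> (\<integral>x. (t * cmod (f x) - cmod (g x))\<^sup>2 \<partial>M)" by simp
    also have "\<dots> = (\<integral>x. t\<^sup>2 * (cmod (f x))\<^sup>2 - 2 * t * cmod (f x * g x) + (cmod (g x))\<^sup>2 \<partial>M)"
      by (rule arg_cong[of _ _ "integral\<^sup>L M"]) (auto simp: fun_eq_iff power2_eq_square norm_mult algebra_simps)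
    also have "\<dots> = t\<^sup>2 * A - 2 * t * C + B"
      unfolding A_def B_def C_def using int fg by simp
    finally show ?thesis .
  qed
  have "C\<^sup>2 \<le> A * B"
  proof (cases "A = 0")
    case True
    have "C = 0"
    proof (rule ccontr)
      assume "C \<noteq> 0"
      \<comment> \<open>For \<open>A = 0\<close> the polynomial is linear in \<open>t\<close>; at this \<open>t\<close> it equals \<open>- 1\<close>.\<close>
      then show False using q[of "(B + 1) / (2 * C)"] True pos by (simp add: field_simps)
    qed
    then show ?thesis using True by simp
  next
    case False
    \<comment> \<open>The minimum of the quadratic polynomial is at \<open>t = C / A\<close>.\<close>
    then show ?thesis using q[of "C / A"] pos
      by (simp add: field_simps power2_eq_square)
  qed
  then have "C \<le> sqrt (A * B)" by (rule real_le_rsqrt)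
  then show ?thesis by (simp add: A_def B_def C_def real_sqrt_mult)
qed

section \<open>Integration over the circle\<close>

lemma space_circle_measure [simp]: "space circle_measure = sphere 0 1"
  by (simp add: circle_measure_def space_restrict_space)

lemma cis_measurable_circle [measurable]: "cis \<in> borel \<rightarrow>\<^sub>M restrict_space borel (sphere 0 1)"
  by (intro measurable_restrict_space2 borel_measurable_continuous_onI continuous_intros) auto

text \<open>
  A real-valued density is the form in which Bochner integrals can be transferred to
  Lebesgue measure.
\<close>

lemma circle_measure_density:
  "circle_measure = distr (density lborel (\<lambda>t. ennreal (indicator {0..2*pi} t / (2*pi))))
     (restrict_space borel (sphere 0 1)) cis"
proof -
  have "indicator {0..2*pi} t / emeasure lborel {0..2*pi} = ennreal (indicator {0..2*pi} t / (2*pi))"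
    for t :: real
    by (auto simp: indicator_def divide_ennreal simp flip: ennreal_1)
  then show ?thesis
    by (simp add: circle_measure_def uniform_measure_def)
qed

lemma emeasure_circle: "emeasure circle_measure (sphere 0 1) = 1"
proof -
  have *: "emeasure lborel {0..2*pi} = ennreal (2*pi)" by simp
  have "cis -` sphere 0 1 \<inter> space (uniform_measure lborel {0..2*pi}) = UNIV" by auto
  then have "emeasure circle_measure (sphere 0 1) = emeasure (uniform_measure lborel {0..2*pi}) UNIV"
    by (subst circle_measure_def, subst emeasure_distr)
       (auto simp: space_restrict_space sets_restrict_space intro!: measurable_restrict_space2)
  also have "\<dots> = 1"
    by (subst emeasure_uniform_measure) (auto simp: divide_eq_1_ennreal)
  finally show ?thesis .
qed

interpretation circle: finite_measure circle_measure
  by standard (simp add: emeasure_circle)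

lemma measure_circle [simp]: "measure circle_measure (sphere 0 1) = 1"
  by (simp add: measure_def emeasure_circle)

lemma borel_measurable_continuous_circle:
  "continuous_on (sphere 0 1) h \<Longrightarrow> h \<in> borel_measurable circle_measure"
  by (simp add: measurable_cong_sets[OF sets_circle_measure refl] borel_measurable_continuous_on_restrict)

lemma integral_circle:
  fixes h :: "complex \<Rightarrow> complex"
  assumes "continuous_on (sphere 0 1) h"
  shows "(\<integral>z. h z \<partial>circle_measure) = integral {0..2*pi} (\<lambda>t. h (cis t)) / (2*pi)"
proof -
  have [measurable]: "h \<in> borel_measurable (restrict_space borel (sphere 0 1))"
    using assms by (rule borel_measurable_continuous_on_restrict)
  have [measurable]: "(\<lambda>t. h (cis t)) \<in> borel_measurable borel"
    by measurable
  have cont: "continuous_on {0..2*pi} (\<lambda>t. h (cis t))"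
    by (rule continuous_on_compose2[OF assms]) (auto intro: continuous_intros)
  have "(\<integral>z. h z \<partial>circle_measure)
      = (\<integral>t. (indicator {0..2*pi} t / (2*pi)) *\<^sub>R h (cis t) \<partial>lborel)"
    unfolding circle_measure_density
    by (subst integral_distr) (auto simp: integral_density)
  also have "\<dots> = (\<integral>t. (1/(2*pi)) *\<^sub>R (indicator {0..2*pi} t *\<^sub>R h (cis t)) \<partial>lborel)"
    by (rule arg_cong[of _ _ "integral\<^sup>L lborel"]) (auto simp: fun_eq_iff)
  also have "\<dots> = (1/(2*pi)) *\<^sub>R (LINT t:{0..2*pi}|lborel. h (cis t))"
    unfolding set_lebesgue_integral_def by (rule integral_scaleR_right)
  also have "(LINT t:{0..2*pi}|lborel. h (cis t)) = integral {0..2*pi} (\<lambda>t. h (cis t))"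
    by (rule set_borel_integral_eq_integral(2)) (rule borel_integrable_atLeastAtMost', rule cont)
  finally show ?thesis by (simp add: scaleR_conv_of_real)
qed

text \<open>
  Cauchy's theorem on the circle of radius \<open>r\<close>: up to the factor \<open>2 \<pi>
  \<i> r\<close>, which absorbs one power of \<open>z\<close>, normalised arc length is the
  contour differential.
\<close>

lemma integral_holomorphic_dilation:
  assumes H: "H holomorphic_on ball 0 1" and r: "0 < r" "r < (1::real)"
  shows "(\<integral>z. z * H (of_real r * z) \<partial>circle_measure) = 0"
proof -
  have sub: "path_image (part_circlepath 0 r 0 (2*pi)) \<subseteq> ball 0 1"
    using path_image_part_circlepath_subset[of 0 "2*pi" r 0] r by (auto simp: sphere_def)
  have "(H has_contour_integral 0) (part_circlepath 0 r 0 (2*pi))"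
  proof (rule Cauchy_theorem_convex_simple[OF H])
    show "pathfinish (part_circlepath 0 r 0 (2*pi)) = pathstart (part_circlepath 0 r 0 (2*pi))"
      by (simp add: pathstart_def pathfinish_def part_circlepath_def linepath_def exp_eq_1)
  qed (use sub in auto)
  then have *: "((\<lambda>t. H (0 + of_real r * cis t) * of_real r * \<i> * cis t) has_integral 0) {0..2*pi}"
    by (subst (asm) has_contour_integral_part_circlepath_iff) auto
  have "((\<lambda>t. (H (0 + of_real r * cis t) * of_real r * \<i> * cis t) * inverse (of_real r * \<i>))
      has_integral 0 * inverse (of_real r * \<i>)) {0..2*pi}"
    by (rule has_integral_mult_left[OF *])
  then have "((\<lambda>t. cis t * H (of_real r * cis t)) has_integral 0) {0..2*pi}"
    using r by (simp add: field_simps)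
  moreover have "continuous_on (sphere 0 1) (\<lambda>z. z * H (of_real r * z))"
    by (intro continuous_intros continuous_on_compose2[OF holomorphic_on_imp_continuous_on[OF H]])
      (use r in \<open>auto simp: norm_mult\<close>)
  ultimately show ?thesis
    by (subst integral_circle) (auto simp: integral_unique)
qed

abbreviation sq_norm :: "(complex \<Rightarrow> complex) \<Rightarrow> real" where
  "sq_norm f \<equiv> \<integral>z. (cmod (f z))\<^sup>2 \<partial>circle_measure"

lemma AE_circle: "AE z in circle_measure. cmod z = 1"
  by (rule AE_I2) simp

lemma integral_circle_cong:
  assumes "\<And>z. cmod z = 1 \<Longrightarrow> f z = g z"
  shows "(\<integral>z. f z \<partial>circle_measure) = (\<integral>z. g z \<partial>circle_measure)"
  by (rule Bochner_Integration.integral_cong) (auto simp: assms)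

lemma sq_int_continuous:
  assumes h: "continuous_on (sphere 0 1) h"
  shows "sq_int circle_measure h"
  unfolding sq_int_def
proof
  note [measurable] = borel_measurable_continuous_circle[OF h]
  show "h \<in> borel_measurable circle_measure" by measurable
  have "compact (h ` sphere 0 1)" by (intro compact_continuous_image h compact_sphere)
  then obtain B where B: "\<And>z. z \<in> sphere 0 1 \<Longrightarrow> cmod (h z) \<le> B"
    unfolding bounded_iff by (meson compact_imp_bounded bounded_iff imageI)
  show "integrable circle_measure (\<lambda>x. (cmod (h x))\<^sup>2)"
    by (rule circle.integrable_const_bound[of _ "B\<^sup>2"]) (auto intro!: AE_I2 power_mono B)
qed

lemma measurable_circle_id [measurable]: "(\<lambda>z. z) \<in> borel_measurable circle_measure"
  by (rule borel_measurable_continuous_circle) (rule continuous_on_id)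

lemma integrable_sq_int:
  assumes "sq_int circle_measure f"
  shows "integrable circle_measure f"
  using integrable_mult_sq_int[OF assms sq_int_continuous[of "\<lambda>_. 1"]] by simp

lemma integral_norm_le_sq_norm:
  assumes "sq_int circle_measure f"
  shows "(\<integral>z. cmod (f z) \<partial>circle_measure) \<le> sqrt (sq_norm f)"
  using integral_Cauchy_Schwarz[OF assms sq_int_continuous[of "\<lambda>_. 1"]] by simp

lemma sq_int_mult_bounded_on_circle:
  assumes "sq_int circle_measure f" "u \<in> borel_measurable circle_measure"
    "\<And>z. cmod z = 1 \<Longrightarrow> cmod (u z) \<le> C"
  shows "sq_int circle_measure (\<lambda>z. u z * f z)"
  by (rule sq_int_bounded_mult[of _ _ _ C]) (use assms in auto)

section \<open>Fourier coefficients of non-negative index\<close>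

text \<open>
  Orthonormality of the monomials. After cancelling equal powers of \<open>z\<close> and its
  conjugate, the case \<open>n \<noteq> m\<close> leaves a positive power of
  \<open>z\<close> or of its conjugate, whose mean vanishes by Cauchy's theorem.
\<close>

lemma integral_monomials_circle:
  "(\<integral>z. z ^ n * cnj z ^ m \<partial>circle_measure) = (if n = m then 1 else 0)"
proof -
  have zz: "z * cnj z = 1" if "cmod z = 1" for z
    using that complex_norm_square[of z] by simp
  have pos: "(\<integral>z. z ^ k \<partial>circle_measure) = 0" if "k > 0" for k
  proof -
    from that obtain j where k: "k = Suc j" by (cases k) auto
    \<comment> \<open>Any radius in the open unit interval serves here.\<close>
    have "(\<integral>z. z * (\<lambda>w. w ^ j) (of_real (1/2) * z) \<partial>circle_measure) = 0"
      by (rule integral_holomorphic_dilation) (auto intro: holomorphic_intros)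
    also have "(\<lambda>z::complex. z * (\<lambda>w. w ^ j) (of_real (1/2) * z)) = (\<lambda>z. of_real ((1/2)^j) * z ^ k)"
      by (auto simp: fun_eq_iff k power_mult_distrib power_divide)
    finally show ?thesis by simp
  qed
  have split: "(\<integral>z. z ^ (k + m) * cnj z ^ m \<partial>circle_measure) = (\<integral>z. z ^ k \<partial>circle_measure)" for k m
  proof (rule integral_circle_cong)
    fix z :: complex assume "cmod z = 1"
    then have "(z * cnj z) ^ m = 1" by (simp add: zz)
    then show "z ^ (k + m) * cnj z ^ m = z ^ k" by (simp add: power_add power_mult_distrib mult.assoc)
  qed
  show ?thesis
  proof (cases n m rule: linorder_cases)
    case equal
    then show ?thesis using split[of 0 m] by simp
  next
    case greater
    then show ?thesis using split[of "n - m" m] pos[of "n - m"] by simp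
  next
    case less
    have "(\<integral>z. z ^ n * cnj z ^ m \<partial>circle_measure) = (\<integral>z. cnj (z ^ m * cnj z ^ n) \<partial>circle_measure)"
      by (simp add: mult.commute)
    also have "\<dots> = cnj (\<integral>z. z ^ m * cnj z ^ n \<partial>circle_measure)"
      by (rule Bochner_Integration.integral_cnj)
    finally show ?thesis using less split[of "m - n" n] pos[of "m - n"] by simp
  qed
qed

definition fcoeff :: "(complex \<Rightarrow> complex) \<Rightarrow> nat \<Rightarrow> complex" where
  "fcoeff f n = (\<integral>z. f z * cnj z ^ n \<partial>circle_measure)"

text \<open>
  The one-term expansion from which both Parseval's identity for finite sums and Bessel's
  inequality follow by induction on the number of terms.
\<close>

lemma sq_norm_minus_monomial:
  assumes u: "sq_int circle_measure u"
  shows "sq_norm (\<lambda>z. u z - c * z ^ N) = sq_norm u - 2 * Re (cnj c * fcoeff u N) + (cmod c)\<^sup>2"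
proof -
  have int: "integrable circle_measure (\<lambda>z. u z * cnj z ^ N)"
    by (intro integrable_mult_sq_int u sq_int_continuous continuous_intros)
  have int2: "integrable circle_measure (\<lambda>z. cnj c * (u z * cnj z ^ N))"
    using int by simp
  note Re_int = integrable_Re[OF int2]
  have "sq_norm (\<lambda>z. u z - c * z ^ N)
      = (\<integral>z. (cmod (u z))\<^sup>2 - 2 * Re (cnj c * (u z * cnj z ^ N)) + (cmod c)\<^sup>2 \<partial>circle_measure)"
  proof (rule Bochner_Integration.integral_cong)
    fix z assume "z \<in> space circle_measure"
    then have "cmod z = 1" by simp
    then have "cmod (c * z ^ N) = cmod c" by (simp add: norm_mult norm_power)
    moreover have "(cmod (a - b))\<^sup>2 = (cmod a)\<^sup>2 - 2 * Re (cnj b * a) + (cmod b)\<^sup>2" for a b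
      by (simp only: cmod_power2) (simp add: power2_eq_square algebra_simps)
    ultimately show "(cmod (u z - c * z ^ N))\<^sup>2
        = (cmod (u z))\<^sup>2 - 2 * Re (cnj c * (u z * cnj z ^ N)) + (cmod c)\<^sup>2"
      by (simp only: complex_cnj_mult complex_cnj_power mult_ac)
  qed simp
  also have "\<dots> = sq_norm u - 2 * (\<integral>z. Re (cnj c * (u z * cnj z ^ N)) \<partial>circle_measure) + (cmod c)\<^sup>2"
    using sq_int_integrable[OF u] Re_int by (simp only: Bochner_Integration.integral_add Bochner_Integration.integral_diff
        Bochner_Integration.integral_mult_right_zero integrable_mult_right Bochner_Integration.integrable_diff circle.integrable_const lebesgue_integral_const) simp
  also have "(\<integral>z. Re (cnj c * (u z * cnj z ^ N)) \<partial>circle_measure) = Re (cnj c * fcoeff u N)"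
    using integral_Re[OF int2] by (simp add: fcoeff_def)
  finally show ?thesis .
qed

lemma fcoeff_diff:
  assumes "sq_int circle_measure f" "sq_int circle_measure g"
  shows "fcoeff (\<lambda>z. f z - g z) n = fcoeff f n - fcoeff g n"
  unfolding fcoeff_def left_diff_distrib
  by (intro Bochner_Integration.integral_diff integrable_mult_sq_int assms sq_int_continuous continuous_intros)

lemma fcoeff_trig_sum: "fcoeff (\<lambda>z. \<Sum>n<N. a n * z ^ n) m = (if m < N then a m else 0)"
proof -
  have int: "integrable circle_measure (\<lambda>z. z ^ n * cnj z ^ m)" for n
    by (intro integrable_mult_sq_int sq_int_continuous continuous_intros)
  have "fcoeff (\<lambda>z. \<Sum>n<N. a n * z ^ n) m = (\<integral>z. (\<Sum>n<N. a n * (z ^ n * cnj z ^ m)) \<partial>circle_measure)"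
    by (simp only: fcoeff_def sum_distrib_right mult.assoc)
  also have "\<dots> = (\<Sum>n<N. a n * (if n = m then 1 else 0))"
    using int by (simp add: integral_monomials_circle)
  also have "\<dots> = (if m < N then a m else 0)"
    by (simp add: if_distrib[of "\<lambda>x. _ * x"] sum.delta cong: if_cong)
  finally show ?thesis .
qed

lemma sq_norm_trig_sum: "sq_norm (\<lambda>z. \<Sum>n<N. a n * z ^ n) = (\<Sum>n<N. (cmod (a n))\<^sup>2)"
proof (induction N)
  case (Suc N)
  have "sq_norm (\<lambda>z. \<Sum>n<Suc N. a n * z ^ n) = sq_norm (\<lambda>z. (\<Sum>n<N. a n * z ^ n) - (- a N) * z ^ N)"
    by simp
  also have "\<dots> = (\<Sum>n<N. (cmod (a n))\<^sup>2) + (cmod (a N))\<^sup>2"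
    by (subst sq_norm_minus_monomial)
      (auto intro!: sq_int_continuous continuous_intros simp: fcoeff_trig_sum Suc.IH)
  finally show ?case by simp
qed simp

lemma Bessel_inequality:
  assumes f: "sq_int circle_measure f"
  shows "(\<Sum>n<N. (cmod (fcoeff f n))\<^sup>2) \<le> sq_norm f"
proof -
  have "sq_norm (\<lambda>z. f z - (\<Sum>n<N. fcoeff f n * z ^ n)) = sq_norm f - (\<Sum>n<N. (cmod (fcoeff f n))\<^sup>2)"
  proof (induction N)
    case (Suc N)
    define u where "u = (\<lambda>z. f z - (\<Sum>n<N. fcoeff f n * z ^ n))"
    have "sq_int circle_measure (\<lambda>z. \<Sum>n<N. fcoeff f n * z ^ n)"
      by (intro sq_int_continuous continuous_intros)
    then have u: "sq_int circle_measure u" "fcoeff u N = fcoeff f N"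
      unfolding u_def by (auto intro: sq_int_diff f simp: fcoeff_diff f fcoeff_trig_sum)
    have "sq_norm (\<lambda>z. f z - (\<Sum>n<Suc N. fcoeff f n * z ^ n)) = sq_norm (\<lambda>z. u z - fcoeff f N * z ^ N)"
      by (simp add: u_def algebra_simps)
    also have "\<dots> = sq_norm u - (cmod (fcoeff f N))\<^sup>2"
    proof -
      have "cnj c * c = of_real ((cmod c)\<^sup>2)" for c
        by (simp only: complex_norm_square mult.commute)
      then have "Re (cnj c * c) = (cmod c)\<^sup>2" for c by (simp only: Re_complex_of_real)
      then show ?thesis unfolding sq_norm_minus_monomial[OF u(1)] u(2) by simp
    qed
    finally show ?case using Suc.IH by (simp add: u_def)
  qed simp
  moreover have "0 \<le> sq_norm (\<lambda>z. f z - (\<Sum>n<N. fcoeff f n * z ^ n))" by simp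
  ultimately show ?thesis by simp
qed

lemma summable_fcoeff:
  assumes "sq_int circle_measure f"
  shows "summable (\<lambda>n. (cmod (fcoeff f n))\<^sup>2)"
  by (rule summableI_nonneg_bounded[of _ "sq_norm f"]) (use Bessel_inequality[OF assms] in auto)

section \<open>Riesz-Fischer for analytic Fourier series\<close>

text \<open>
  Fatou's lemma turns Parseval's identity for the partial sums into a bound for any
  almost-everywhere limit of a sequence of them. It is applied to boundary functions, to
  their dilations and to remainders, with the coefficients \<open>b\<close> chosen
  accordingly.
\<close>

lemma sq_norm_AE_limit_trig_sums:
  assumes b: "summable (\<lambda>n. (cmod (b n))\<^sup>2)"
    and [measurable]: "g \<in> borel_measurable circle_measure"
    and lim: "AE z in circle_measure. (\<lambda>k. \<Sum>n<N k. b n * z ^ n) \<longlonglongrightarrow> g z"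
  shows "sq_int circle_measure g" and "sq_norm g \<le> (\<Sum>n. (cmod (b n))\<^sup>2)"
proof -
  let ?S = "\<lambda>k z. \<Sum>n<N k. b n * z ^ n"
  have [measurable]: "?S k \<in> borel_measurable circle_measure" for k
    by (intro borel_measurable_continuous_circle continuous_intros)
  have S: "(\<integral>\<^sup>+z. ennreal ((cmod (?S k z))\<^sup>2) \<partial>circle_measure) \<le> ennreal (\<Sum>n. (cmod (b n))\<^sup>2)" for k
  proof -
    have "sq_int circle_measure (?S k)" by (intro sq_int_continuous continuous_intros)
    then have "(\<integral>\<^sup>+z. ennreal ((cmod (?S k z))\<^sup>2) \<partial>circle_measure) = ennreal (sq_norm (?S k))"
      by (intro nn_integral_eq_integral sq_int_integrable) auto
    also have "\<dots> \<le> ennreal (\<Sum>n. (cmod (b n))\<^sup>2)"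
      unfolding sq_norm_trig_sum by (intro ennreal_leI sum_le_suminf b) auto
    finally show ?thesis .
  qed
  have "(\<integral>\<^sup>+z. ennreal ((cmod (g z))\<^sup>2) \<partial>circle_measure)
      = (\<integral>\<^sup>+z. liminf (\<lambda>k. ennreal ((cmod (?S k z))\<^sup>2)) \<partial>circle_measure)"
  proof (rule nn_integral_cong_AE)
    show "AE z in circle_measure. ennreal ((cmod (g z))\<^sup>2) = liminf (\<lambda>k. ennreal ((cmod (?S k z))\<^sup>2))"
      using lim
    proof eventually_elim
      case (elim z)
      then have "(\<lambda>k. ennreal ((cmod (?S k z))\<^sup>2)) \<longlonglongrightarrow> ennreal ((cmod (g z))\<^sup>2)"
        by (intro tendsto_intros)
      then show ?case by (rule lim_imp_Liminf[OF sequentially_bot, symmetric])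
    qed
  qed
  also have "\<dots> \<le> liminf (\<lambda>k. \<integral>\<^sup>+z. ennreal ((cmod (?S k z))\<^sup>2) \<partial>circle_measure)"
    by (intro nn_integral_liminf) measurable
  also have "\<dots> \<le> ennreal (\<Sum>n. (cmod (b n))\<^sup>2)"
    using S by (intro Liminf_le) (auto intro: always_eventually)
  finally have *: "(\<integral>\<^sup>+z. ennreal ((cmod (g z))\<^sup>2) \<partial>circle_measure) \<le> ennreal (\<Sum>n. (cmod (b n))\<^sup>2)" .
  show g: "sq_int circle_measure g"
    unfolding sq_int_def
    by (auto intro!: integrableI_bounded le_less_trans[OF *])
  have "ennreal (sq_norm g) \<le> ennreal (\<Sum>n. (cmod (b n))\<^sup>2)"
    using * sq_int_integrable[OF g] by (subst (asm) nn_integral_eq_integral) auto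
  then show "sq_norm g \<le> (\<Sum>n. (cmod (b n))\<^sup>2)"
    by (subst (asm) ennreal_le_iff) (auto intro: suminf_nonneg b)
qed

lemma suminf_tail:
  fixes c :: "nat \<Rightarrow> real"
  assumes "summable c"
  shows "summable (\<lambda>n. if n < m then 0 else c n)"
    and "(\<Sum>n. if n < m then 0 else c n) = suminf c - (\<Sum>n<m. c n)"
proof -
  have "(\<lambda>n. c n - (if n \<in> {..<m} then c n else 0)) sums (suminf c - (\<Sum>n<m. c n))"
    by (intro sums_diff summable_sums assms sums_If_finite_set) simp
  also have "(\<lambda>n. c n - (if n \<in> {..<m} then c n else 0)) = (\<lambda>n. if n < m then 0 else c n)"
    by auto
  finally show "summable (\<lambda>n. if n < m then 0 else c n)"
    and "(\<Sum>n. if n < m then 0 else c n) = suminf c - (\<Sum>n<m. c n)"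
    by (auto simp: sums_iff)
qed

text \<open>
  Choose partial sums so sparsely that the \<open>k\<close>-th block between two of them has
  L2 norm, hence L1 norm, at most \<open>(1/2)^k\<close>. Then the sum of the absolute
  values of the blocks is integrable, so the blocks are absolutely summable almost
  everywhere.
\<close>

lemma trig_sums_AE_convergent_subseq:
  assumes a: "summable (\<lambda>n. (cmod (a n))\<^sup>2)"
  obtains h N where "h \<in> borel_measurable circle_measure" "strict_mono (N :: nat \<Rightarrow> nat)"
    "AE z in circle_measure. (\<lambda>k. \<Sum>n<N k. a n * z ^ n) \<longlonglongrightarrow> h z"
proof -
  let ?c = "\<lambda>n. (cmod (a n))\<^sup>2"
  have "(\<lambda>m. suminf ?c - (\<Sum>n<m. ?c n)) \<longlonglongrightarrow> suminf ?c - suminf ?c"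
    by (intro tendsto_intros summable_LIMSEQ a)
  then have small: "\<exists>m\<ge>j. suminf ?c - (\<Sum>n<m. ?c n) < (1/4)^k" for k j
  proof -
    have "eventually (\<lambda>m. suminf ?c - (\<Sum>n<m. ?c n) < (1/4)^k) sequentially"
      using \<open>_ \<longlonglongrightarrow> _\<close> by (intro order_tendstoD(2)[of _ 0]) auto
    then have "eventually (\<lambda>m. m \<ge> j \<and> suminf ?c - (\<Sum>n<m. ?c n) < (1/4)^k) sequentially"
      by (intro eventually_conj eventually_ge_at_top)
    then show ?thesis by (metis (mono_tags, lifting) eventually_sequentially order_refl)
  qed
  have "\<exists>N. \<forall>k. suminf ?c - (\<Sum>n<N k. ?c n) < (1/4)^k \<and> N k < N (Suc k)"
  proof (rule dependent_nat_choice)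
    show "\<exists>x. suminf ?c - (\<Sum>n<x. ?c n) < (1/4)^0" using small[of 0 0] by blast
    show "\<exists>y. suminf ?c - (\<Sum>n<y. ?c n) < (1/4)^Suc k \<and> x < y" for x k
      using small[of "Suc x" "Suc k"] by (metis Suc_le_lessD)
  qed
  then obtain N where N: "\<And>k. suminf ?c - (\<Sum>n<N k. ?c n) < (1/4)^k" and mono: "\<And>k. N k < N (Suc k)"
    by blast
  define u where "u = (\<lambda>k z. (\<Sum>n<N (Suc k). (if n < N k then 0 else a n) * z ^ n))"
  have u_sq: "sq_int circle_measure (u k)" for k
    unfolding u_def by (intro sq_int_continuous continuous_intros)
  have [measurable]: "u k \<in> borel_measurable circle_measure" for k
    using sq_int_measurable[OF u_sq] .
  have u_int: "(\<integral>z. cmod (u k z) \<partial>circle_measure) \<le> (1/2)^k" for k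
  proof -
    have "sq_norm (u k) = (\<Sum>n<N (Suc k). (cmod (if n < N k then 0 else a n))\<^sup>2)"
      unfolding u_def by (rule sq_norm_trig_sum)
    also have "\<dots> = (\<Sum>n<N (Suc k). if n < N k then 0 else ?c n)"
      by (intro sum.cong) auto
    also have "\<dots> \<le> (\<Sum>n. if n < N k then 0 else ?c n)"
      by (intro sum_le_suminf suminf_tail a) auto
    also have "\<dots> \<le> (1/4)^k"
      using N[of k] by (simp add: suminf_tail[OF a])
    also have "(1/4)^k = ((1/2::real)^k)\<^sup>2"
      by (simp add: power2_eq_square flip: power_mult_distrib)
    finally have "sqrt (sq_norm (u k)) \<le> (1/2)^k"
      by (intro real_le_lsqrt) auto
    with integral_norm_le_sq_norm[OF u_sq] show ?thesis by (rule order_trans)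
  qed
  have "AE z in circle_measure. (\<Sum>k. ennreal (cmod (u k z))) \<noteq> \<infinity>"
  proof (rule nn_integral_noteq_infinite)
    have "(\<integral>\<^sup>+z. (\<Sum>k. ennreal (cmod (u k z))) \<partial>circle_measure)
        = (\<Sum>k. \<integral>\<^sup>+z. ennreal (cmod (u k z)) \<partial>circle_measure)"
      by (intro nn_integral_suminf) measurable
    also have "\<dots> \<le> (\<Sum>k. ennreal ((1/2)^k))"
    proof (intro suminf_le)
      fix k
      have "(\<integral>\<^sup>+z. ennreal (cmod (u k z)) \<partial>circle_measure) = ennreal (\<integral>z. cmod (u k z) \<partial>circle_measure)"
        by (intro nn_integral_eq_integral integrable_norm integrable_sq_int u_sq) auto
      then show "(\<integral>\<^sup>+z. ennreal (cmod (u k z)) \<partial>circle_measure) \<le> ennreal ((1/2)^k)"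
        using u_int[of k] by (simp add: ennreal_leI)
    qed auto
    also have "\<dots> = ennreal (\<Sum>k. (1/2)^k)"
      by (intro suminf_ennreal2 summable_geometric) auto
    finally show "(\<integral>\<^sup>+z. (\<Sum>k. ennreal (cmod (u k z))) \<partial>circle_measure) \<noteq> \<infinity>"
      by (auto simp: top_unique)
  qed measurable
  then have conv: "AE z in circle_measure. convergent (\<lambda>k. \<Sum>n<N k. a n * z ^ n)"
  proof eventually_elim
    case (elim z)
    then have "summable (\<lambda>k. cmod (u k z))"
      by (intro summable_suminf_not_top) auto
    then have "summable (\<lambda>k. u k z)" by (rule summable_norm_cancel)
    then have "convergent (\<lambda>K. (\<Sum>k<K. u k z) + (\<Sum>n<N 0. a n * z ^ n))"
      by (intro convergent_add convergent_const) (simp add: summable_iff_convergent)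
    moreover have "(\<Sum>k<K. u k z) + (\<Sum>n<N 0. a n * z ^ n) = (\<Sum>n<N K. a n * z ^ n)" for K
    proof (induction K)
      case (Suc K)
      have "(\<Sum>n<N (Suc K). a n * z ^ n) = (\<Sum>n<N (Suc K). (if n < N K then 0 else a n) * z ^ n)
          + (\<Sum>n<N (Suc K). (if n \<in> {..<N K} then a n * z ^ n else 0))"
        unfolding sum.distrib[symmetric] by (intro sum.cong) auto
      also have "(\<Sum>n<N (Suc K). (if n \<in> {..<N K} then a n * z ^ n else 0)) = (\<Sum>n<N K. a n * z ^ n)"
        using mono[of K] by (subst sum.inter_restrict[symmetric]) (auto intro!: sum.cong)
      finally show ?case using Suc.IH by (simp add: u_def)
    qed simp
    ultimately show ?case by simp
  qed
  have S [measurable]: "(\<lambda>z. \<Sum>n<N k. a n * z ^ n) \<in> borel_measurable circle_measure" for k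
    by (intro borel_measurable_continuous_circle continuous_intros)
  show ?thesis
  proof
    show "(\<lambda>z. lim (\<lambda>k. \<Sum>n<N k. a n * z ^ n)) \<in> borel_measurable circle_measure"
      by (rule borel_measurable_lim_metric) measurable
    show "strict_mono N" using mono by (simp add: strict_mono_Suc_iff)
    show "AE z in circle_measure. (\<lambda>k. \<Sum>n<N k. a n * z ^ n) \<longlonglongrightarrow> lim (\<lambda>k. \<Sum>n<N k. a n * z ^ n)"
      using conv by eventually_elim (simp add: convergent_LIMSEQ_iff)
  qed
qed

lemma summable_power_series_disk:
  assumes a: "summable (\<lambda>n. (cmod (a n))\<^sup>2)" and w: "cmod w < 1"
  shows "summable (\<lambda>n. a n * w ^ n)"
proof -
  have "Bseq (\<lambda>n. (cmod (a n))\<^sup>2)"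
    using summable_imp_Bseq[OF a] .
  then obtain K where K: "K > 0" "\<And>n. norm ((cmod (a n))\<^sup>2) \<le> K" by (auto simp: Bseq_def)
  show ?thesis
  proof (rule summable_comparison_test')
    show "summable (\<lambda>n. sqrt K * cmod w ^ n)"
      using w by (intro summable_mult summable_geometric) auto
    show "norm (a n * w ^ n) \<le> sqrt K * cmod w ^ n" if "n \<ge> 0" for n
      using K(2)[of n] by (auto simp: norm_mult norm_power intro!: mult_right_mono real_le_rsqrt)
  qed
qed

text \<open>
  The boundary function \<open>h\<close> is the almost-everywhere limit of partial sums of
  the power series \<open>F\<close> with coefficients \<open>a\<close>. The dilation of
  \<open>F\<close> by \<open>r\<close> has the coefficients \<open>a n * r ^ n\<close>, so
  its L2 distance to \<open>h\<close> is controlled by the series of \<open>|a n|\<^sup>2 (1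
  - r ^ n)\<^sup>2\<close>, which tends to 0 by dominated convergence of series.
\<close>

lemma hardy_function_of_coefficients:
  assumes a: "summable (\<lambda>n. (cmod (a n))\<^sup>2)"
  obtains F h where "F \<in> hardy_disk" "sq_int circle_measure h"
    "((\<lambda>r. sq_norm (\<lambda>z. F (of_real r * z) - h z)) \<longlongrightarrow> 0) (at_left 1)"
    "\<And>n. fcoeff h n = a n"
proof -
  from trig_sums_AE_convergent_subseq[OF a] obtain h N where
    [measurable]: "h \<in> borel_measurable circle_measure" and N: "strict_mono (N :: nat \<Rightarrow> nat)"
    and lim: "AE z in circle_measure. (\<lambda>k. \<Sum>n<N k. a n * z ^ n) \<longlonglongrightarrow> h z" .
  have Ntop: "filterlim N at_top sequentially" by (rule filterlim_subseq[OF N])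
  define F where "F = (\<lambda>w. \<Sum>n. a n * w ^ n)"
  have F_sums: "(\<lambda>n. a n * w ^ n) sums F w" if "cmod w < 1" for w
    unfolding F_def by (intro summable_sums summable_power_series_disk a that)
  have F_hol: "F holomorphic_on ball 0 1"
    by (rule power_series_holomorphic[where a = a]) (use F_sums in auto)
  have F_lim: "(\<lambda>k. \<Sum>n<N k. (a n * of_real r ^ n) * z ^ n) \<longlonglongrightarrow> F (of_real r * z)"
    if "0 \<le> r" "r < 1" "cmod z = 1" for r z
  proof -
    have "(\<lambda>n. a n * (of_real r * z) ^ n) sums F (of_real r * z)"
      by (rule F_sums) (use that in \<open>simp add: norm_mult\<close>)
    then have "(\<lambda>m. \<Sum>n<m. (a n * of_real r ^ n) * z ^ n) \<longlonglongrightarrow> F (of_real r * z)"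
      by (simp add: sums_def power_mult_distrib mult.assoc)
    then show ?thesis by (rule filterlim_compose[OF _ Ntop])
  qed
  have F_meas: "(\<lambda>z. F (of_real r * z)) \<in> borel_measurable circle_measure" if "0 \<le> r" "r < 1" for r
    using measurable_dilation[OF F_hol] that by (cases "r = 0") auto
  have F_norm: "sq_norm (\<lambda>z. F (of_real r * z)) \<le> (\<Sum>n. (cmod (a n))\<^sup>2)" if r: "0 \<le> r" "r < 1" for r
  proof -
    have le: "(cmod (a n * of_real r ^ n))\<^sup>2 \<le> (cmod (a n))\<^sup>2" for n
      using r power_le_one[of r n]
      by (intro power_mono) (auto simp: norm_mult norm_power intro!: mult_left_le)
    have s: "summable (\<lambda>n. (cmod (a n * of_real r ^ n))\<^sup>2)"
      by (rule summable_comparison_test'[OF a]) (use le in auto)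
    have "sq_norm (\<lambda>z. F (of_real r * z)) \<le> (\<Sum>n. (cmod (a n * of_real r ^ n))\<^sup>2)"
      by (rule sq_norm_AE_limit_trig_sums(2)[OF s F_meas[OF r]]) (auto intro!: AE_I2 F_lim r)
    also have "\<dots> \<le> (\<Sum>n. (cmod (a n))\<^sup>2)"
      by (rule suminf_le[OF le s a])
    finally show ?thesis .
  qed
  have F_hardy: "F \<in> hardy_disk"
    unfolding hardy_disk_def using F_hol F_norm
    by (auto intro!: exI[of _ "\<Sum>n. (cmod (a n))\<^sup>2"])
  have h: "sq_int circle_measure h"
    by (rule sq_norm_AE_limit_trig_sums(1)[OF a _ lim]) measurable
  have F_diff: "sq_norm (\<lambda>z. F (of_real r * z) - h z) \<le> (\<Sum>n. (cmod (a n))\<^sup>2 * (1 - r ^ n)\<^sup>2)"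
    if r: "0 \<le> r" "r < 1" for r
  proof -
    note [measurable] = F_meas[OF r]
    have eq: "(cmod (a n * (of_real r ^ n - 1)))\<^sup>2 = (cmod (a n))\<^sup>2 * (1 - r ^ n)\<^sup>2" for n
    proof -
      have "cmod (of_real r ^ n - 1) = \<bar>r ^ n - 1\<bar>"
        by (metis norm_of_real of_real_1 of_real_diff of_real_power)
      then show ?thesis
        by (simp add: norm_mult power_mult_distrib power2_commute)
    qed
    have le: "(cmod (a n))\<^sup>2 * (1 - r ^ n)\<^sup>2 \<le> (cmod (a n))\<^sup>2" for n
      using r power_le_one[of r n] by (intro mult_left_le power_le_one) auto
    have s: "summable (\<lambda>n. (cmod (a n * (of_real r ^ n - 1)))\<^sup>2)"
      unfolding eq by (rule summable_comparison_test'[OF a]) (use le in auto)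
    have "sq_norm (\<lambda>z. F (of_real r * z) - h z) \<le> (\<Sum>n. (cmod (a n * (of_real r ^ n - 1)))\<^sup>2)"
    proof (rule sq_norm_AE_limit_trig_sums(2)[OF s])
      show "AE z in circle_measure.
          (\<lambda>k. \<Sum>n<N k. a n * (of_real r ^ n - 1) * z ^ n) \<longlonglongrightarrow> F (of_real r * z) - h z"
        using lim AE_circle
      proof eventually_elim
        case (elim z)
        have "(\<lambda>k. (\<Sum>n<N k. (a n * of_real r ^ n) * z ^ n) - (\<Sum>n<N k. a n * z ^ n))
            \<longlonglongrightarrow> F (of_real r * z) - h z"
          by (intro tendsto_diff F_lim r elim)
        then show ?case by (simp add: algebra_simps flip: sum_subtractf)
      qed
    qed measurable
    then show ?thesis unfolding eq .
  qed
  have "((\<lambda>r. \<Sum>n. (cmod (a n))\<^sup>2 * (1 - r ^ n)\<^sup>2) \<longlongrightarrow> (\<Sum>n::nat. (0::real))) (at_left 1)"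
  proof (intro conjunct2[OF conjunct2[OF tannerys_theorem]])
    show "((\<lambda>r. (cmod (a n))\<^sup>2 * (1 - r ^ n)\<^sup>2) \<longlongrightarrow> 0) (at_left 1)" for n
      by (rule tendsto_eq_intros refl | simp)+
    have ev: "eventually (\<lambda>r::real. r \<in> {0<..<1}) (at_left 1)"
      by (rule eventually_at_left_real) simp
    show "\<forall>\<^sub>F (n, r) in at_top \<times>\<^sub>F at_left (1::real). norm ((cmod (a n))\<^sup>2 * (1 - r ^ n)\<^sup>2) \<le> (cmod (a n))\<^sup>2"
      unfolding eventually_prod_filter
    proof (intro exI conjI allI impI)
      show "eventually (\<lambda>_::nat. True) at_top" by simp
      show "eventually (\<lambda>r::real. r \<in> {0<..<1}) (at_left 1)" by (rule ev)
      fix n :: nat and r :: real assume "r \<in> {0<..<1}"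
      then show "case (n, r) of (n, r) \<Rightarrow> norm ((cmod (a n))\<^sup>2 * (1 - r ^ n)\<^sup>2) \<le> (cmod (a n))\<^sup>2"
        using power_le_one[of r n] by (auto intro!: mult_left_le power_le_one)
    qed
  qed (use a in auto)
  then have lim0: "((\<lambda>r. \<Sum>n. (cmod (a n))\<^sup>2 * (1 - r ^ n)\<^sup>2) \<longlongrightarrow> 0) (at_left 1)" by simp
  have F_tendsto: "((\<lambda>r. sq_norm (\<lambda>z. F (of_real r * z) - h z)) \<longlongrightarrow> 0) (at_left 1)"
  proof (rule tendsto_sandwich[OF _ _ tendsto_const lim0])
    have "eventually (\<lambda>r::real. r \<in> {0<..<1}) (at_left 1)"
      by (rule eventually_at_left_real) simp
    then show "\<forall>\<^sub>F r in at_left 1. sq_norm (\<lambda>z. F (of_real r * z) - h z) \<le> (\<Sum>n. (cmod (a n))\<^sup>2 * (1 - r ^ n)\<^sup>2)"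
      by eventually_elim (auto intro!: F_diff)
  qed auto
  have coeff: "fcoeff h m = a m" for m
  proof -
    let ?c = "\<lambda>n. (cmod (a n))\<^sup>2"
    have bound: "cmod (fcoeff h m - a m) \<le> sqrt (suminf ?c - (\<Sum>n<N k. ?c n))" if k: "N k > m" for k
    proof -
      let ?S = "\<lambda>z. \<Sum>n<N k. a n * z ^ n"
      \<comment> \<open>The remainder \<open>h - ?S\<close> is the limit of partial sums with the coefficients \<open>?b\<close>.\<close>
      let ?b = "\<lambda>n. if n < N k then 0 else a n"
      have S: "sq_int circle_measure ?S" by (intro sq_int_continuous continuous_intros)
      have D: "sq_int circle_measure (\<lambda>z. h z - ?S z)" by (rule sq_int_diff[OF h S])
      note [measurable] = sq_int_measurable[OF D]
      have cb: "(cmod (?b n))\<^sup>2 = (if n < N k then 0 else ?c n)" for n by simp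
      have "sq_norm (\<lambda>z. h z - ?S z) \<le> (\<Sum>n. (cmod (?b n))\<^sup>2)"
      proof (rule sq_norm_AE_limit_trig_sums(2))
        show "summable (\<lambda>n. (cmod (?b n))\<^sup>2)" unfolding cb by (rule suminf_tail[OF a])
        show "AE z in circle_measure. (\<lambda>j. \<Sum>n<N (j + k). ?b n * z ^ n) \<longlonglongrightarrow> h z - ?S z"
          using lim
        proof eventually_elim
          case (elim z)
          then have "(\<lambda>j. \<Sum>n<N (j + k). a n * z ^ n) \<longlonglongrightarrow> h z" by (rule LIMSEQ_ignore_initial_segment)
          then have "(\<lambda>j. (\<Sum>n<N (j + k). a n * z ^ n) - ?S z) \<longlonglongrightarrow> h z - ?S z"
            by (intro tendsto_intros)
          moreover have "(\<Sum>n<N (j + k). a n * z ^ n) - ?S z = (\<Sum>n<N (j + k). ?b n * z ^ n)" for j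
          proof -
            have "N k \<le> N (j + k)" using N by (simp add: strict_mono_less_eq)
            then have "?S z = (\<Sum>n<N (j + k). if n \<in> {..<N k} then a n * z ^ n else 0)"
              by (subst sum.inter_restrict[symmetric]) (auto intro!: sum.cong)
            then show ?thesis
              by (auto simp flip: sum_subtractf intro!: sum.cong)
          qed
          ultimately show ?case by simp
        qed
      qed measurable
      also have "\<dots> = suminf ?c - (\<Sum>n<N k. ?c n)" unfolding cb by (rule suminf_tail[OF a])
      finally have le: "sq_norm (\<lambda>z. h z - ?S z) \<le> suminf ?c - (\<Sum>n<N k. ?c n)" .
      have "fcoeff h m - a m = fcoeff (\<lambda>z. h z - ?S z) m"
        using k by (simp add: fcoeff_diff[OF h S] fcoeff_trig_sum)
      also have "cmod \<dots> \<le> (\<integral>z. cmod ((h z - ?S z) * cnj z ^ m) \<partial>circle_measure)"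
        unfolding fcoeff_def by (rule integral_norm_bound)
      also have "\<dots> = (\<integral>z. cmod (h z - ?S z) \<partial>circle_measure)"
        by (rule Bochner_Integration.integral_cong) (auto simp: norm_mult norm_power)
      also have "\<dots> \<le> sqrt (sq_norm (\<lambda>z. h z - ?S z))"
        by (rule integral_norm_le_sq_norm[OF D])
      also have "\<dots> \<le> sqrt (suminf ?c - (\<Sum>n<N k. ?c n))"
        using le by simp
      finally show ?thesis .
    qed
    have "(\<lambda>k. sqrt (suminf ?c - (\<Sum>n<N k. ?c n))) \<longlonglongrightarrow> sqrt (suminf ?c - suminf ?c)"
      by (intro tendsto_intros filterlim_compose[OF summable_LIMSEQ[OF a] Ntop])
    moreover have "eventually (\<lambda>k. cmod (fcoeff h m - a m) \<le> sqrt (suminf ?c - (\<Sum>n<N k. ?c n))) sequentially"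
    proof -
      have "eventually (\<lambda>k. N k \<ge> Suc m) sequentially"
        using Ntop by (auto simp: filterlim_at_top)
      then show ?thesis by eventually_elim (auto intro: bound)
    qed
    ultimately have "cmod (fcoeff h m - a m) \<le> sqrt (suminf ?c - suminf ?c)"
      by (intro tendsto_lowerbound[of _ _ sequentially]) auto
    then show ?thesis by simp
  qed
  show ?thesis
    by (rule that[OF F_hardy h F_tendsto coeff])
qed

section \<open>Completeness of the trigonometric system\<close>

text \<open>
  The vanishing of all Fourier coefficients of a square-integrable function. Indices of both
  signs are covered by powers of \<open>z\<close> and of its conjugate, which keeps the
  condition visibly stable under multiplication by \<open>z\<close> and under conjugation.
\<close>

definition fourier_null :: "(complex \<Rightarrow> complex) \<Rightarrow> bool" where
  "fourier_null f \<longleftrightarrow> sq_int circle_measure f \<and>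
     (\<forall>n::nat. (\<integral>z. f z * z ^ n \<partial>circle_measure) = 0) \<and>
     (\<forall>n::nat. (\<integral>z. f z * cnj z ^ n \<partial>circle_measure) = 0)"

lemma fourier_null_add:
  assumes "fourier_null f" "fourier_null g"
  shows "fourier_null (\<lambda>z. f z + g z)"
proof -
  have int: "integrable circle_measure (\<lambda>z. h z * z ^ n)" "integrable circle_measure (\<lambda>z. h z * cnj z ^ n)"
    if "fourier_null h" for h n
    using that by (auto simp: fourier_null_def intro!: integrable_mult_sq_int sq_int_continuous continuous_intros)
  show ?thesis
    using assms int[OF assms(1)] int[OF assms(2)]
    by (auto simp: fourier_null_def distrib_right intro: sq_int_add)
qed

lemma fourier_null_cmult:
  assumes "fourier_null f"
  shows "fourier_null (\<lambda>z. c * f z)"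
  using assms by (auto simp: fourier_null_def mult.assoc intro: sq_int_cmult)

lemma fourier_null_times_z:
  assumes f: "fourier_null f"
  shows "fourier_null (\<lambda>z. z * f z)"
  unfolding fourier_null_def
proof (intro conjI allI)
  show "sq_int circle_measure (\<lambda>z. z * f z)"
    using f by (intro sq_int_mult_bounded_on_circle[of _ _ 1]) (auto simp: fourier_null_def)
  show "(\<integral>z. z * f z * z ^ n \<partial>circle_measure) = 0" for n
    using f[unfolded fourier_null_def] by (metis (no_types, lifting) Bochner_Integration.integral_cong mult.assoc mult.left_commute power_Suc)
  show "(\<integral>z. z * f z * cnj z ^ n \<partial>circle_measure) = 0" for n
  proof (cases n)
    case 0
    have "(\<integral>z. f z * z ^ 1 \<partial>circle_measure) = 0" using f unfolding fourier_null_def by blast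
    then show ?thesis using 0 by (simp add: mult.commute)
  next
    case (Suc m)
    have "(\<integral>z. z * f z * cnj z ^ n \<partial>circle_measure) = (\<integral>z. f z * cnj z ^ m \<partial>circle_measure)"
    proof (rule integral_circle_cong)
      fix z :: complex assume "cmod z = 1"
      then have "z * cnj z = 1" using complex_norm_square[of z] by simp
      then show "z * f z * cnj z ^ n = f z * cnj z ^ m"
        by (simp add: Suc mult_ac)
    qed
    then show ?thesis using f by (simp add: fourier_null_def)
  qed
qed

lemma fourier_null_cnj:
  assumes "fourier_null f"
  shows "fourier_null (\<lambda>z. cnj (f z))"
proof -
  have "(\<integral>z. cnj (f z) * z ^ n \<partial>circle_measure) = cnj (\<integral>z. f z * cnj z ^ n \<partial>circle_measure)"
    "(\<integral>z. cnj (f z) * cnj z ^ n \<partial>circle_measure) = cnj (\<integral>z. f z * z ^ n \<partial>circle_measure)" for n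
    by (simp_all flip: Bochner_Integration.integral_cnj)
  then show ?thesis using assms by (simp add: fourier_null_def sq_int_cnj)
qed

text \<open>
  On the complex plane, a real polynomial function is a polynomial in \<open>z\<close> and
  its conjugate, and multiplication by either of them only shifts the Fourier coefficients.
\<close>

lemma fourier_null_times_polynomial:
  assumes "real_polynomial_function p" "fourier_null f"
  shows "fourier_null (\<lambda>z. of_real (p z) * f z)"
  using assms
proof (induction arbitrary: f rule: real_polynomial_function.induct)
  case (linear p)
  \<comment> \<open>A real-linear form on the plane is \<open>\<alpha> z\<close> plus its conjugate.\<close>
  define \<alpha> where "\<alpha> = Complex (p 1 / 2) (- p \<i> / 2)"
  interpret p: bounded_linear p by fact
  have "of_real (p z) = \<alpha> * z + cnj \<alpha> * cnj z" for z
  proof -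
    have "p z = p (Re z *\<^sub>R 1 + Im z *\<^sub>R \<i>)"
      by (rule arg_cong[of _ _ p]) (simp add: complex_eq_iff)
    also have "\<dots> = Re z * p 1 + Im z * p \<i>" by (simp only: p.add p.scaleR) simp
    finally show ?thesis by (simp add: complex_eq_iff \<alpha>_def algebra_simps)
  qed
  then have eq: "(\<lambda>z. of_real (p z) * f z) = (\<lambda>z. \<alpha> * (z * f z) + cnj \<alpha> * cnj (z * cnj (f z)))"
    by (simp add: fun_eq_iff algebra_simps)
  show ?case unfolding eq
    by (intro fourier_null_add fourier_null_cmult fourier_null_times_z fourier_null_cnj linear)
next
  case (const c)
  then show ?case by (rule fourier_null_cmult)
next
  case (add p q)
  from fourier_null_add[OF add.IH(1)[OF add.prems] add.IH(2)[OF add.prems]]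
  show ?case by (simp add: distrib_right)
next
  case (mult p q)
  from mult.IH(1)[OF mult.IH(2)[OF mult.prems]]
  show ?case by (simp add: mult.assoc)
qed

lemma integrable_continuous_mult:
  assumes f: "integrable circle_measure (f :: complex \<Rightarrow> complex)" and g: "continuous_on (sphere 0 1) (g :: complex \<Rightarrow> real)"
  shows "integrable circle_measure (\<lambda>z. of_real (g z) * f z)"
proof -
  have "compact (g ` sphere 0 1)" by (intro compact_continuous_image g compact_sphere)
  then obtain B where B: "\<And>z. z \<in> sphere 0 1 \<Longrightarrow> norm (g z) \<le> B"
    unfolding bounded_iff by (meson compact_imp_bounded bounded_iff imageI)
  note [measurable] = borel_measurable_integrable[OF f]
  have [measurable]: "g \<in> borel_measurable circle_measure"
    using borel_measurable_continuous_on_restrict[OF g]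
    by (simp add: measurable_cong_sets[OF sets_circle_measure refl])
  show ?thesis
  proof (rule Bochner_Integration.integrable_bound)
    show "integrable circle_measure (\<lambda>z. B * cmod (f z))" using f by simp
    show "AE z in circle_measure. norm (of_real (g z) * f z) \<le> norm (B * cmod (f z))"
    proof (rule AE_I2)
      fix z assume "z \<in> space circle_measure"
      then have "\<bar>g z\<bar> \<le> B" using B[of z] by simp
      then show "norm (of_real (g z) * f z) \<le> norm (B * cmod (f z))"
        by (auto simp: norm_mult abs_mult intro!: mult_right_mono)
    qed
  qed measurable
qed

text \<open>
  Stone-Weierstrass: the function \<open>g\<close> is a uniform limit of polynomials, for
  which the integral vanishes.
\<close>

lemma fourier_null_integral_continuous:
  assumes f: "fourier_null f" and g: "continuous_on (sphere 0 1) (g :: complex \<Rightarrow> real)"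
  shows "(\<integral>z. of_real (g z) * f z \<partial>circle_measure) = 0"
proof -
  have fint: "integrable circle_measure f"
    using f by (auto simp: fourier_null_def intro: integrable_sq_int)
  define L where "L = (\<integral>z. cmod (f z) \<partial>circle_measure)"
  have L: "L \<ge> 0" by (simp add: L_def)
  have "cmod (\<integral>z. of_real (g z) * f z \<partial>circle_measure) \<le> e" if "e > 0" for e
  proof -
    \<comment> \<open>Adding 1 avoids a division by zero when \<open>L = 0\<close>.\<close>
    define d where "d = e / (L + 1)"
    have d: "d > 0" using that L by (simp add: d_def)
    obtain p where p: "real_polynomial_function p" "\<And>x. x \<in> sphere 0 1 \<Longrightarrow> \<bar>g x - p x\<bar> < d"
      by (rule Stone_Weierstrass_real_polynomial_function[OF compact_sphere g d]) blast
    have p_cont: "continuous_on (sphere 0 1) p"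
      using p(1) by (simp add: continuous_on_polymonial_function real_polynomial_function_eq)
    have int: "integrable circle_measure (\<lambda>z. of_real (g z) * f z)" "integrable circle_measure (\<lambda>z. of_real (p z) * f z)"
      by (intro integrable_continuous_mult fint g p_cont)+
    have "(\<integral>z. of_real (p z) * f z \<partial>circle_measure) = 0"
    proof -
      have "(\<integral>z. of_real (p z) * f z * z ^ 0 \<partial>circle_measure) = 0"
        using fourier_null_times_polynomial[OF p(1) f] unfolding fourier_null_def by blast
      then show ?thesis by simp
    qed
    then have "(\<integral>z. of_real (g z) * f z \<partial>circle_measure)
        = (\<integral>z. of_real (g z) * f z - of_real (p z) * f z \<partial>circle_measure)"
      using int by simp
    also have "cmod \<dots> \<le> (\<integral>z. cmod (of_real (g z) * f z - of_real (p z) * f z) \<partial>circle_measure)"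
      by (rule integral_norm_bound)
    also have "\<dots> \<le> (\<integral>z. d * cmod (f z) \<partial>circle_measure)"
    proof (rule integral_mono)
      fix z assume "z \<in> space circle_measure"
      then have "\<bar>g z - p z\<bar> \<le> d" using p(2)[of z] by simp
      moreover have "of_real (g z) * f z - of_real (p z) * f z = of_real (g z - p z) * f z"
        by (simp add: algebra_simps)
      ultimately show "cmod (of_real (g z) * f z - of_real (p z) * f z) \<le> d * cmod (f z)"
        by (simp only: norm_mult norm_of_real mult_right_mono norm_ge_zero)
    qed (use int fint in auto)
    also have "\<dots> = d * L" by (simp add: L_def)
    also have "\<dots> \<le> e" using that L by (simp add: d_def field_simps)
    finally show ?thesis .
  qed
  then show ?thesis
    by (metis dense_ge norm_le_zero_iff)
qed

text \<open>
  The indicator of \<open>K\<close> is the pointwise limit of the continuous tents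
  \<open>max 0 (1 - n * infdist z K)\<close>, which are bounded by 1.
\<close>

lemma fourier_null_integral_closed:
  assumes f: "fourier_null f" and K: "closed K"
  shows "(\<integral>z. indicator K z *\<^sub>R f z \<partial>circle_measure) = 0"
proof (cases "K = {}")
  case False
  have fint: "integrable circle_measure f"
    using f by (auto simp: fourier_null_def intro: integrable_sq_int)
  note [measurable] = borel_measurable_integrable[OF fint]
  have KS: "K \<inter> sphere 0 1 \<in> sets circle_measure"
    unfolding sets_circle_measure sets_restrict_space using K by (auto simp: Int_commute)
  define g where "g = (\<lambda>(n::nat) z. max 0 (1 - real n * infdist z K))"
  have g_cont: "continuous_on (sphere 0 1) (g n)" for n
    unfolding g_def by (intro continuous_intros)
  have "(\<lambda>n. \<integral>z. of_real (g n z) * f z \<partial>circle_measure)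
      \<longlonglongrightarrow> (\<integral>z. indicator (K \<inter> sphere 0 1) z *\<^sub>R f z \<partial>circle_measure)"
  proof (rule integral_dominated_convergence[where w = "\<lambda>z. cmod (f z)"])
    show "(\<lambda>z. indicator (K \<inter> sphere 0 1) z *\<^sub>R f z) \<in> borel_measurable circle_measure"
      using KS by measurable
    show "(\<lambda>z. of_real (g n z) * f z) \<in> borel_measurable circle_measure" for n
      by (intro borel_measurable_integrable integrable_continuous_mult fint g_cont)
    show "integrable circle_measure (\<lambda>z. cmod (f z))" using fint by simp
    show "AE z in circle_measure. norm (of_real (g n z) * f z) \<le> cmod (f z)" for n
    proof (rule AE_I2)
      fix z
      have "\<bar>g n z\<bar> \<le> 1" by (simp add: g_def infdist_nonneg)
      then show "norm (of_real (g n z) * f z) \<le> cmod (f z)"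
        by (simp add: norm_mult mult_left_le_one_le)
    qed
    show "AE z in circle_measure. (\<lambda>n. of_real (g n z) * f z) \<longlonglongrightarrow> indicator (K \<inter> sphere 0 1) z *\<^sub>R f z"
    proof (rule AE_I2)
      fix z assume z: "z \<in> space circle_measure"
      have "(\<lambda>n. g n z) \<longlonglongrightarrow> indicator K z"
      proof (cases "z \<in> K")
        case True
        then show ?thesis by (simp add: g_def)
      next
        case zK: False
        then have pos: "infdist z K > 0"
          using in_closed_iff_infdist_zero[OF K False] infdist_nonneg[of z K] by force
        obtain n0 :: nat where n0: "1 / infdist z K < real n0" using reals_Archimedean2 by blast
        have "g n z = 0" if "n \<ge> n0" for n
        proof -
          have "1 / infdist z K < real n" using n0 that by (meson less_le_trans of_nat_le_iff)
          then have "1 < real n * infdist z K" using pos by (simp add: field_simps)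
          then show ?thesis by (simp add: g_def)
        qed
        then have "eventually (\<lambda>n. g n z = 0) sequentially" by (auto simp: eventually_sequentially)
        then show ?thesis using zK by (simp add: tendsto_eventually)
      qed
      then have "(\<lambda>n. of_real (g n z) * f z) \<longlonglongrightarrow> of_real (indicator K z) * f z"
        by (intro tendsto_intros)
      then show "(\<lambda>n. of_real (g n z) * f z) \<longlonglongrightarrow> indicator (K \<inter> sphere 0 1) z *\<^sub>R f z"
        using z by (simp add: scaleR_conv_of_real indicator_def)
    qed
  qed
  then have "(\<integral>z. indicator (K \<inter> sphere 0 1) z *\<^sub>R f z \<partial>circle_measure) = 0"
    by (simp add: fourier_null_integral_continuous[OF f g_cont] LIMSEQ_const_iff)
  also have "(\<integral>z. indicator (K \<inter> sphere 0 1) z *\<^sub>R f z \<partial>circle_measure) = (\<integral>z. indicator K z *\<^sub>R f z \<partial>circle_measure)"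
    by (rule integral_circle_cong) (simp add: indicator_def)
  finally show ?thesis .
qed simp

text \<open>
  The sets over which the integral of \<open>f\<close> vanishes form a Dynkin system
  containing the closed sets, hence all Borel sets.
\<close>

lemma fourier_null_AE_zero:
  assumes f: "fourier_null f"
  shows "AE z in circle_measure. f z = 0"
proof (rule circle.density_zero)
  show fint: "integrable circle_measure f"
    using f by (auto simp: fourier_null_def intro: integrable_sq_int)
  note [measurable] = borel_measurable_integrable[OF fint]
  fix A assume "A \<in> sets circle_measure"
  then obtain B where B: "B \<in> sets borel" "A = B \<inter> sphere 0 1"
    unfolding sets_circle_measure sets_restrict_space by auto
  have sets: "C \<inter> sphere 0 1 \<in> sets circle_measure" if "C \<in> sets borel" for C
    unfolding sets_circle_measure sets_restrict_space using that by (auto simp: Int_commute)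
  have set_int: "set_integrable circle_measure (C \<inter> sphere 0 1) f" if "C \<in> sets borel" for C
    unfolding set_integrable_def using sets[OF that] fint by (rule integrable_mult_indicator)
  have drop: "set_lebesgue_integral circle_measure (C \<inter> sphere 0 1) f = (\<integral>z. indicator C z *\<^sub>R f z \<partial>circle_measure)" for C
    unfolding set_lebesgue_integral_def by (rule integral_circle_cong) (simp add: indicator_def)
  have "Int_stable (Collect closed)" "Collect closed \<subseteq> Pow UNIV" "B \<in> sigma_sets UNIV (Collect closed)"
    using B(1) by (auto simp: Int_stable_def borel_eq_closed)
  then have "set_lebesgue_integral circle_measure (B \<inter> sphere 0 1) f = 0"
  proof (induction rule: sigma_sets_induct_disjoint)
    case (basic K)
    then show ?case by (simp add: drop fourier_null_integral_closed[OF f])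
  next
    case empty
    then show ?case by (simp add: set_lebesgue_integral_def)
  next
    case (compl C)
    then have C: "C \<in> sets borel" by (simp add: borel_eq_closed)
    have "(\<integral>z. indicator UNIV z *\<^sub>R f z \<partial>circle_measure) = 0"
      by (rule fourier_null_integral_closed[OF f]) simp
    then have f0: "(\<integral>z. f z \<partial>circle_measure) = 0" by simp
    have "(\<integral>z. indicator (UNIV - C) z *\<^sub>R f z \<partial>circle_measure)
        = (\<integral>z. f z - indicator (C \<inter> sphere 0 1) z *\<^sub>R f z \<partial>circle_measure)"
      by (rule integral_circle_cong) (simp add: indicator_def)
    also have "\<dots> = (\<integral>z. f z \<partial>circle_measure) - set_lebesgue_integral circle_measure (C \<inter> sphere 0 1) f"
      unfolding set_lebesgue_integral_def
      using fint set_int[OF C] unfolding set_integrable_def by (rule Bochner_Integration.integral_diff)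
    finally show ?case using compl.IH f0 by (simp add: drop)
  next
    case (union C)
    have C: "C i \<in> sets borel" for i using union.hyps(2) by (auto simp: borel_eq_closed)
    have "set_lebesgue_integral circle_measure (\<Union>i. C i \<inter> sphere 0 1) f
        = (\<Sum>i. set_lebesgue_integral circle_measure (C i \<inter> sphere 0 1) f)"
    proof (rule lebesgue_integral_countable_add)
      show "C i \<inter> sphere 0 1 \<in> sets circle_measure" for i by (rule sets[OF C])
      show "C i \<inter> sphere 0 1 \<inter> (C j \<inter> sphere 0 1) = {}" if "i \<noteq> j" for i j
        using union.hyps(1) that by (auto simp: disjoint_family_on_def)
      have "(\<Union>i. C i) \<in> sets borel" using C by auto
      from set_int[OF this] show "set_integrable circle_measure (\<Union>i. C i \<inter> sphere 0 1) f"
        by simp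
    qed
    then show ?case using union.IH by simp
  qed
  then show "set_lebesgue_integral circle_measure A f = 0" by (simp add: B(2))
qed

section \<open>Boundary functions and negative Fourier coefficients\<close>

text \<open>
  For the dilations the integral vanishes by Cauchy's theorem applied to \<open>w ^ m * F w
  * G w\<close>. The products of the dilations converge in L1 to \<open>f * g\<close> by
  Cauchy-Schwarz, because both factors converge in L2. Taking \<open>G = 1\<close> shows
  that boundary functions have no negative Fourier coefficients, taking \<open>m = 0\<close>
  that \<open>H2\<close> and \<open>H2_minus\<close> are orthogonal, and taking for
  \<open>f\<close> an inner function that its multiples by \<open>H2\<close> functions stay
  in \<open>H2\<close>.
\<close>

lemma integral_boundary_product_eq_0:
  assumes F: "F holomorphic_on ball 0 1" and f: "sq_int circle_measure f"
    and Ff: "((\<lambda>r. sq_norm (\<lambda>z. F (of_real r * z) - f z)) \<longlongrightarrow> 0) (at_left 1)"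
    and G: "G holomorphic_on ball 0 1" and g: "sq_int circle_measure g"
    and Gg: "((\<lambda>r. sq_norm (\<lambda>z. G (of_real r * z) - g z)) \<longlongrightarrow> 0) (at_left 1)"
  shows "(\<integral>z. z ^ Suc m * (f z * g z) \<partial>circle_measure) = 0"
proof -
  define A where "A = (\<lambda>r. sq_norm (\<lambda>z. F (of_real r * z) - f z))"
  define B where "B = (\<lambda>r. sq_norm (\<lambda>z. G (of_real r * z) - g z))"
  define E where "E = (\<lambda>r. sqrt (A r) * sqrt (B r) + sqrt (sq_norm f) * sqrt (B r) + sqrt (A r) * sqrt (sq_norm g))"
  have E0: "(E \<longlongrightarrow> sqrt 0 * sqrt 0 + sqrt (sq_norm f) * sqrt 0 + sqrt 0 * sqrt (sq_norm g)) (at_left 1)"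
    unfolding E_def A_def B_def by (intro tendsto_intros Ff Gg)
  have bound: "cmod (\<integral>z. z ^ Suc m * (f z * g z) \<partial>circle_measure) \<le> E r" if r: "0 < r" "r < 1" for r
  proof -
    define Fr where "Fr = (\<lambda>z. F (of_real r * z))"
    define Gr where "Gr = (\<lambda>z. G (of_real r * z))"
    have sq: "sq_int circle_measure Fr" "sq_int circle_measure Gr"
      unfolding Fr_def Gr_def
      by (intro sq_int_continuous continuous_on_compose2[OF holomorphic_on_imp_continuous_on[OF F]]
          continuous_on_compose2[OF holomorphic_on_imp_continuous_on[OF G]] continuous_intros;
          use r in \<open>auto simp: norm_mult\<close>)+
    have sqd: "sq_int circle_measure (\<lambda>z. Fr z - f z)" "sq_int circle_measure (\<lambda>z. Gr z - g z)"
      by (intro sq_int_diff sq f g)+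
    have pw: "integrable circle_measure (\<lambda>z. z ^ Suc m * (p z * q z))"
      if "sq_int circle_measure p" "sq_int circle_measure q" for p q
    proof -
      have "sq_int circle_measure (\<lambda>z. z ^ Suc m * p z)"
        by (rule sq_int_mult_bounded_on_circle[of _ _ 1]) (use that in \<open>auto simp: norm_mult norm_power\<close>)
      from integrable_mult_sq_int[OF this that(2)] show ?thesis by (simp add: mult.assoc)
    qed
    have "(\<integral>z. z * (\<lambda>w. w ^ m * (F w * G w)) (of_real r * z) \<partial>circle_measure) = 0"
      by (rule integral_holomorphic_dilation) (use r in \<open>auto intro!: holomorphic_intros F G\<close>)
    also have "(\<lambda>z::complex. z * (\<lambda>w. w ^ m * (F w * G w)) (of_real r * z))
        = (\<lambda>z. of_real (r ^ m) * (z ^ Suc m * (Fr z * Gr z)))"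
      by (simp add: fun_eq_iff Fr_def Gr_def power_mult_distrib mult_ac)
    finally have "(\<integral>z. z ^ Suc m * (Fr z * Gr z) \<partial>circle_measure) = 0"
      using r by simp
    then have "(\<integral>z. z ^ Suc m * (f z * g z) \<partial>circle_measure)
        = (\<integral>z. z ^ Suc m * (f z * g z) - z ^ Suc m * (Fr z * Gr z) \<partial>circle_measure)"
      using pw[OF f g] pw[OF sq] by (simp del: power_Suc)
    also have "cmod \<dots> \<le> (\<integral>z. cmod (z ^ Suc m * (f z * g z) - z ^ Suc m * (Fr z * Gr z)) \<partial>circle_measure)"
      by (rule integral_norm_bound)
    also have "\<dots> \<le> (\<integral>z. cmod ((Fr z - f z) * (Gr z - g z)) + cmod (f z * (Gr z - g z))
        + cmod ((Fr z - f z) * g z) \<partial>circle_measure)"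
    proof (rule integral_mono)
      fix z assume "z \<in> space circle_measure"
      then have z: "cmod z = 1" by simp
      have "z ^ Suc m * (f z * g z) - z ^ Suc m * (Fr z * Gr z)
          = - (z ^ Suc m) * ((Fr z - f z) * (Gr z - g z) + f z * (Gr z - g z) + (Fr z - f z) * g z)"
        by (simp add: algebra_simps)
      also have "cmod \<dots> = cmod ((Fr z - f z) * (Gr z - g z) + f z * (Gr z - g z) + (Fr z - f z) * g z)"
        using z by (simp only: norm_mult norm_minus_cancel norm_power) simp
      also have "\<dots> \<le> cmod ((Fr z - f z) * (Gr z - g z)) + cmod (f z * (Gr z - g z)) + cmod ((Fr z - f z) * g z)"
        by (intro norm_triangle_mono norm_triangle_ineq order_refl)
      finally show "cmod (z ^ Suc m * (f z * g z) - z ^ Suc m * (Fr z * Gr z)) \<le>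
        cmod ((Fr z - f z) * (Gr z - g z)) + cmod (f z * (Gr z - g z)) + cmod ((Fr z - f z) * g z)" .
    qed (intro integrable_norm Bochner_Integration.integrable_diff Bochner_Integration.integrable_add
          pw integrable_mult_sq_int f g sq sqd)+
    also have "\<dots> = (\<integral>z. cmod ((Fr z - f z) * (Gr z - g z)) \<partial>circle_measure)
        + (\<integral>z. cmod (f z * (Gr z - g z)) \<partial>circle_measure)
        + (\<integral>z. cmod ((Fr z - f z) * g z) \<partial>circle_measure)"
      by (simp only: Bochner_Integration.integral_add Bochner_Integration.integrable_add
          integrable_norm integrable_mult_sq_int f g sqd)
    also have "\<dots> \<le> E r"
      unfolding E_def A_def B_def
      using integral_Cauchy_Schwarz[OF sqd] integral_Cauchy_Schwarz[OF f sqd(2)]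
        integral_Cauchy_Schwarz[OF sqd(1) g]
      unfolding Fr_def Gr_def by linarith
    finally show ?thesis .
  qed
  have "eventually (\<lambda>r::real. r \<in> {0<..<1}) (at_left 1)"
    by (rule eventually_at_left_real) simp
  then have "eventually (\<lambda>r. cmod (\<integral>z. z ^ Suc m * (f z * g z) \<partial>circle_measure) \<le> E r) (at_left 1)"
    by eventually_elim (rule bound, auto)
  from tendsto_lowerbound[OF E0 this]
  show ?thesis by simp
qed

text \<open>
  The boundary function with the same non-negative Fourier coefficients as \<open>f\<close>
  has no negative ones either, so it agrees with \<open>f\<close> almost everywhere.
\<close>

lemma hardy_function_of_vanishing_negative_coefficients:
  assumes f: "sq_int circle_measure f"
    and neg: "\<And>n. (\<integral>z. z ^ Suc n * f z \<partial>circle_measure) = 0"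
  shows "\<exists>F\<in>hardy_disk. ((\<lambda>r. sq_norm (\<lambda>z. F (of_real r * z) - f z)) \<longlongrightarrow> 0) (at_left 1)"
proof -
  obtain F h where F: "F \<in> hardy_disk" and h: "sq_int circle_measure h"
    and lim: "((\<lambda>r. sq_norm (\<lambda>z. F (of_real r * z) - h z)) \<longlongrightarrow> 0) (at_left 1)"
    and coeff: "\<And>n. fcoeff h n = fcoeff f n"
    by (rule hardy_function_of_coefficients[OF summable_fcoeff[OF f]]) blast
  have hol: "F holomorphic_on ball 0 1" using F by (simp add: hardy_disk_def)
  have neg_h: "(\<integral>z. z ^ Suc n * h z \<partial>circle_measure) = 0" for n
    using integral_boundary_product_eq_0[OF hol h lim, of "\<lambda>_. 1" "\<lambda>_. 1" n]
    by (simp add: sq_int_continuous)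
  have int: "integrable circle_measure (\<lambda>z. p z * z ^ n)" if "sq_int circle_measure p" for p n
    by (rule integrable_mult_sq_int[OF that sq_int_continuous]) (intro continuous_intros)
  have "fourier_null (\<lambda>z. f z - h z)"
    unfolding fourier_null_def
  proof (intro conjI allI)
    show "sq_int circle_measure (\<lambda>z. f z - h z)" by (rule sq_int_diff[OF f h])
    show c: "(\<integral>z. (f z - h z) * cnj z ^ n \<partial>circle_measure) = 0" for n
      using fcoeff_diff[OF f h, of n] coeff[of n] by (simp add: fcoeff_def)
    show "(\<integral>z. (f z - h z) * z ^ n \<partial>circle_measure) = 0" for n
    proof (cases n)
      case 0
      then show ?thesis using c[of 0] by simp
    next
      case (Suc k)
      have "(\<integral>z. (f z - h z) * z ^ Suc k \<partial>circle_measure)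
          = (\<integral>z. f z * z ^ Suc k \<partial>circle_measure) - (\<integral>z. h z * z ^ Suc k \<partial>circle_measure)"
        unfolding left_diff_distrib by (intro Bochner_Integration.integral_diff int f h)
      then show ?thesis using neg[of k] neg_h[of k] Suc by (simp add: mult.commute)
    qed
  qed
  then have ae: "AE z in circle_measure. f z - h z = 0" by (rule fourier_null_AE_zero)
  have "((\<lambda>r. sq_norm (\<lambda>z. F (of_real r * z) - f z)) \<longlongrightarrow> 0) (at_left 1)"
  proof (rule Lim_transform_eventually[OF lim])
    have "eventually (\<lambda>r::real. r \<in> {0<..<1}) (at_left 1)"
      by (rule eventually_at_left_real) simp
    then show "\<forall>\<^sub>F r in at_left 1. sq_norm (\<lambda>z. F (of_real r * z) - h z) = sq_norm (\<lambda>z. F (of_real r * z) - f z)"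
    proof eventually_elim
      case (elim r)
      then have [measurable]: "(\<lambda>z. F (of_real r * z)) \<in> borel_measurable circle_measure"
        using measurable_dilation[OF hol] by simp
      note [measurable] = sq_int_measurable[OF f] sq_int_measurable[OF h]
      show ?case by (rule integral_cong_AE) (use ae in auto)
    qed
  qed
  with F show ?thesis by blast
qed

section \<open>Algebra and inner product of almost-everywhere classes\<close>

lemma circle_eq_refl: "circle_eq f f \<longleftrightarrow> f \<in> borel_measurable circle_measure"
  by (simp add: circle_eq_def)

lemma circle_eq_sq_int:
  "circle_eq f f \<Longrightarrow> integrable circle_measure (\<lambda>z. (cmod (f z))\<^sup>2) \<longleftrightarrow> sq_int circle_measure f"
  by (simp add: circle_eq_def sq_int_def)

lemma circle_cnj_add: "circle_cnj (f + g) = circle_cnj f + circle_cnj g"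
  by transfer (simp add: circle_eq_def)

lemma circle_cnj_diff: "circle_cnj (f - g) = circle_cnj f - circle_cnj g"
  by transfer (simp add: circle_eq_def)

lemma circle_cnj_mult: "circle_cnj (f * g) = circle_cnj f * circle_cnj g"
  by transfer (simp add: circle_eq_def)

lemma circle_cnj_cnj [simp]: "circle_cnj (circle_cnj f) = f"
  by transfer (simp add: circle_eq_def)

lemma circle_cnj_const: "circle_cnj (circle_const c) = circle_const (cnj c)"
  by transfer (simp add: circle_eq_def)

lemma unimodular_cancel: "unimodular u \<Longrightarrow> circle_cnj u * (u * f) = f"
proof transfer
  fix u f :: "complex \<Rightarrow> complex"
  assume m: "circle_eq u u" "circle_eq f f" and "AE z in circle_measure. cmod (u z) = 1"
  from this(3) have "AE z in circle_measure. cnj (u z) * (u z * f z) = f z"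
  proof eventually_elim
    case (elim z)
    then have "cnj (u z) * u z = 1" using complex_norm_square[of "u z"] by (simp add: mult.commute)
    then show ?case by (simp flip: mult.assoc)
  qed
  with m show "circle_eq (\<lambda>z. cnj (u z) * (u z * f z)) f" by (simp add: circle_eq_def)
qed

lemma unimodular_cnj: "unimodular u \<Longrightarrow> unimodular (circle_cnj u)"
  by transfer simp

lemma unimodular_mult: "unimodular u \<Longrightarrow> unimodular v \<Longrightarrow> unimodular (u * v)"
proof transfer
  fix u v :: "complex \<Rightarrow> complex"
  assume "AE z in circle_measure. cmod (u z) = 1" "AE z in circle_measure. cmod (v z) = 1"
  then show "AE z in circle_measure. cmod (u z * v z) = 1"
    by eventually_elim (simp add: norm_mult)
qed

lemma unimodular_z: "unimodular circle_z"
  by transfer (rule AE_circle)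

lemma unimodular_Linf: "unimodular u \<Longrightarrow> u \<in> Linf"
  unfolding Linf_def mem_Collect_eq
proof transfer
  fix u :: "complex \<Rightarrow> complex"
  assume "AE z in circle_measure. cmod (u z) = 1"
  then have "AE z in circle_measure. cmod (u z) \<le> 1"
    by eventually_elim simp
  then show "\<exists>C. AE z in circle_measure. cmod (u z) \<le> C" by blast
qed

lemma Linf_cnj: "u \<in> Linf \<Longrightarrow> circle_cnj u \<in> Linf"
  unfolding Linf_def mem_Collect_eq by transfer simp

lemma L2_add: "f \<in> L2 \<Longrightarrow> g \<in> L2 \<Longrightarrow> f + g \<in> L2"
  unfolding L2_def mem_Collect_eq
  by transfer (metis circle_eq_sq_int sq_int_add sq_int_integrable)

lemma L2_diff: "f \<in> L2 \<Longrightarrow> g \<in> L2 \<Longrightarrow> f - g \<in> L2"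
  unfolding L2_def mem_Collect_eq
  by transfer (metis circle_eq_sq_int sq_int_diff sq_int_integrable)

lemma L2_zero: "0 \<in> L2"
  unfolding L2_def mem_Collect_eq by transfer simp

lemma L2_cnj: "f \<in> L2 \<Longrightarrow> circle_cnj f \<in> L2"
  unfolding L2_def mem_Collect_eq by transfer simp

lemma L2_Linf_mult: "u \<in> Linf \<Longrightarrow> f \<in> L2 \<Longrightarrow> u * f \<in> L2"
  unfolding L2_def Linf_def mem_Collect_eq
proof transfer
  fix u f :: "complex \<Rightarrow> complex"
  assume "circle_eq u u" "circle_eq f f" "\<exists>C. AE z in circle_measure. cmod (u z) \<le> C"
    "integrable circle_measure (\<lambda>z. (cmod (f z))\<^sup>2)"
  then show "integrable circle_measure (\<lambda>z. (cmod (u z * f z))\<^sup>2)"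
    using sq_int_bounded_mult[of circle_measure f u] by (auto simp: circle_eq_sq_int circle_eq_refl sq_int_integrable)
qed

lemma L2_const_mult: "f \<in> L2 \<Longrightarrow> circle_const c * f \<in> L2"
  unfolding L2_def mem_Collect_eq
  by transfer (metis circle_eq_sq_int sq_int_cmult sq_int_integrable)

lemma L2_inner_add_left: "f \<in> L2 \<Longrightarrow> g \<in> L2 \<Longrightarrow> h \<in> L2 \<Longrightarrow> L2_inner (f + g) h = L2_inner f h + L2_inner g h"
  unfolding L2_def mem_Collect_eq
  by transfer (simp add: circle_eq_sq_int distrib_right integrable_mult_sq_int sq_int_cnj)

lemma L2_inner_diff_left: "f \<in> L2 \<Longrightarrow> g \<in> L2 \<Longrightarrow> h \<in> L2 \<Longrightarrow> L2_inner (f - g) h = L2_inner f h - L2_inner g h"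
  unfolding L2_def mem_Collect_eq
  by transfer (simp add: circle_eq_sq_int left_diff_distrib integrable_mult_sq_int sq_int_cnj)

lemma L2_inner_commute: "L2_inner g f = cnj (L2_inner f g)"
  by transfer (simp flip: Bochner_Integration.integral_cnj add: mult.commute)

lemma L2_inner_mult_left: "L2_inner (u * f) g = L2_inner f (circle_cnj u * g)"
  by transfer (simp add: mult_ac)

lemma L2_inner_cnj: "L2_inner (circle_cnj f) (circle_cnj g) = L2_inner g f"
  by transfer (simp add: mult_ac)

lemma L2_inner_zero_left [simp]: "L2_inner 0 g = 0"
  by transfer simp

lemma L2_inner_self_eq_0: "f \<in> L2 \<Longrightarrow> L2_inner f f = 0 \<Longrightarrow> f = 0"
  unfolding L2_def mem_Collect_eq
proof transfer
  fix f assume f: "circle_eq f f" "integrable circle_measure (\<lambda>z. (cmod (f z))\<^sup>2)"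
    and 0: "(\<integral>z. f z * cnj (f z) \<partial>circle_measure) = 0"
  have "(\<integral>z. f z * cnj (f z) \<partial>circle_measure) = of_real (sq_norm f)"
    unfolding complex_norm_square[symmetric] by (simp only: of_real_power[symmetric] integral_complex_of_real)
  with 0 have "sq_norm f = 0" by simp
  then have "AE z in circle_measure. (cmod (f z))\<^sup>2 = 0"
    using integral_nonneg_eq_0_iff_AE[OF f(2)] by simp
  then show "circle_eq f (\<lambda>_. 0)" using f(1) by (simp add: circle_eq_def)
qed

lemma L2_inner_const_left: "L2_inner (circle_const c * f) g = c * L2_inner f g"
  by transfer (simp add: mult.assoc)

lemma L2_inner_diff_right: "f \<in> L2 \<Longrightarrow> g \<in> L2 \<Longrightarrow> h \<in> L2 \<Longrightarrow> L2_inner h (f - g) = L2_inner h f - L2_inner h g"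
  by (metis L2_inner_diff_left L2_inner_commute complex_cnj_diff L2_diff)

lemma L2_inner_eq_0_commute: "L2_inner f g = 0 \<longleftrightarrow> L2_inner g f = 0"
  by (metis L2_inner_commute complex_cnj_zero)

lemma L2_unimodular_mult: "unimodular u \<Longrightarrow> f \<in> L2 \<Longrightarrow> u * f \<in> L2"
  by (intro L2_Linf_mult unimodular_Linf)

lemma L2_norm_unimodular_mult: "unimodular u \<Longrightarrow> L2_norm (u * f) = L2_norm f"
proof transfer
  fix u f :: "complex \<Rightarrow> complex"
  assume "circle_eq u u" "circle_eq f f" and u: "AE z in circle_measure. cmod (u z) = 1"
  then have [measurable]: "u \<in> borel_measurable circle_measure" "f \<in> borel_measurable circle_measure"
    by (simp_all add: circle_eq_refl)
  have "AE z in circle_measure. (cmod (u z * f z))\<^sup>2 = (cmod (f z))\<^sup>2"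
    using u by eventually_elim (simp add: norm_mult)
  then have "sq_norm (\<lambda>z. u z * f z) = sq_norm f"
    by (intro integral_cong_AE) auto
  then show "sqrt (sq_norm (\<lambda>z. u z * f z)) = sqrt (sq_norm f)" by simp
qed

lemma L2_norm_cnj: "L2_norm (circle_cnj f) = L2_norm f"
  by transfer simp

section \<open>The Hardy space inside L2\<close>

text \<open>
  The monomials test for negative Fourier coefficients: the integral of \<open>f * z ^
  n\<close> is \<open>L2_inner (circle_zpow n) (circle_cnj f)\<close>.
\<close>

lift_definition circle_zpow :: "nat \<Rightarrow> circle_fun" is "\<lambda>n z. z ^ n"
  by (simp add: circle_eq_refl)

lemma circle_zpow_Suc: "circle_zpow (Suc n) = circle_z * circle_zpow n"
  by transfer (simp add: circle_eq_refl)

lemma circle_zpow_Suc_0: "circle_zpow (Suc 0) = circle_z"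
  by transfer (simp add: circle_eq_refl)

lemma L2_zpow: "circle_zpow n \<in> L2"
  unfolding L2_def mem_Collect_eq
  by transfer (intro sq_int_integrable sq_int_continuous continuous_intros)

lemma L2_inner_zpow_boundary_product:
  assumes "boundary_function F f" "boundary_function G g"
  shows "L2_inner (circle_zpow (Suc n)) (circle_cnj (f * g)) = 0"
  using assms unfolding boundary_function_def L2_def mem_Collect_eq
proof transfer
  fix F G f g :: "complex \<Rightarrow> complex" and n
  assume "circle_eq f f" "circle_eq g g"
    and F: "integrable circle_measure (\<lambda>z. (cmod (f z))\<^sup>2) \<and> F holomorphic_on ball 0 1 \<and>
      ((\<lambda>r. sq_norm (\<lambda>z. F (of_real r * z) - f z)) \<longlongrightarrow> 0) (at_left 1)"
    and G: "integrable circle_measure (\<lambda>z. (cmod (g z))\<^sup>2) \<and> G holomorphic_on ball 0 1 \<and>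
      ((\<lambda>r. sq_norm (\<lambda>z. G (of_real r * z) - g z)) \<longlongrightarrow> 0) (at_left 1)"
  then have "sq_int circle_measure f" "sq_int circle_measure g" by (simp_all add: circle_eq_sq_int)
  with F G have "(\<integral>z. z ^ Suc n * (f z * g z) \<partial>circle_measure) = 0"
    by (intro integral_boundary_product_eq_0[of F f G g]) auto
  then show "(\<integral>z. z ^ Suc n * cnj (cnj (f z * g z)) \<partial>circle_measure) = 0" by simp
qed

text \<open>
  The spectral description of \<open>H2\<close>. Being linear in \<open>f\<close>, it gives
  the vector space structure and all later membership proofs without reference to
  holomorphic extensions.
\<close>

lemma H2_iff: "f \<in> H2 \<longleftrightarrow> f \<in> L2 \<and> (\<forall>n. L2_inner (circle_zpow (Suc n)) (circle_cnj f) = 0)"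
  unfolding H2_def boundary_function_def L2_def mem_Collect_eq
proof transfer
  fix f assume f: "circle_eq f f"
  show "(\<exists>F\<in>hardy_disk. integrable circle_measure (\<lambda>z. (cmod (f z))\<^sup>2) \<and> F holomorphic_on ball 0 1 \<and>
      ((\<lambda>r. sq_norm (\<lambda>z. F (of_real r * z) - f z)) \<longlongrightarrow> 0) (at_left 1)) \<longleftrightarrow>
     integrable circle_measure (\<lambda>z. (cmod (f z))\<^sup>2) \<and>
     (\<forall>n. (\<integral>z. z ^ Suc n * cnj (cnj (f z)) \<partial>circle_measure) = 0)" (is "?l \<longleftrightarrow> ?r")
  proof
    assume ?l
    then obtain F where F: "sq_int circle_measure f" "F holomorphic_on ball 0 1"
      "((\<lambda>r. sq_norm (\<lambda>z. F (of_real r * z) - f z)) \<longlongrightarrow> 0) (at_left 1)"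
      using f by (auto simp: circle_eq_sq_int)
    then show ?r
      using integral_boundary_product_eq_0[OF F(2,1,3), of "\<lambda>_. 1" "\<lambda>_. 1"]
      by (simp add: sq_int_continuous sq_int_integrable)
  next
    assume ?r
    then show ?l
      using hardy_function_of_vanishing_negative_coefficients[of f] f
      by (auto simp: circle_eq_sq_int sq_int_integrable hardy_disk_def)
  qed
qed

lemma H2_L2: "f \<in> H2 \<Longrightarrow> f \<in> L2"
  by (simp add: H2_iff)

lemma H2_minus_L2: "f \<in> H2_minus \<Longrightarrow> f \<in> L2"
  unfolding H2_minus_def
  by (auto intro!: L2_unimodular_mult unimodular_cnj unimodular_z L2_cnj) (rule H2_L2)

lemma H2_diff: "f \<in> H2 \<Longrightarrow> g \<in> H2 \<Longrightarrow> f - g \<in> H2"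
  by (simp add: H2_iff L2_diff circle_cnj_diff L2_inner_diff_right L2_zpow L2_cnj)

lemma H2_mult_inner:
  assumes "inner_function \<theta>" "h \<in> H2"
  shows "\<theta> * h \<in> H2"
proof -
  obtain F G where "boundary_function F \<theta>" "boundary_function G h"
    using assms by (auto simp: H2_def inner_function_def)
  then have "L2_inner (circle_zpow (Suc n)) (circle_cnj (\<theta> * h)) = 0" for n
    by (rule L2_inner_zpow_boundary_product)
  moreover have "\<theta> * h \<in> L2"
    using assms by (intro L2_unimodular_mult H2_L2) (auto simp: inner_function_def)
  ultimately show ?thesis by (simp add: H2_iff)
qed

lemma H2_orthogonal_H2_minus:
  assumes "f \<in> H2" "g \<in> H2_minus"
  shows "L2_inner f g = 0"
proof -
  obtain k where k: "k \<in> H2" "g = circle_cnj circle_z * circle_cnj k"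
    using assms(2) by (auto simp: H2_minus_def)
  obtain F G where FG: "boundary_function F f" "boundary_function G k"
    using assms(1) k(1) by (auto simp: H2_def)
  have "L2_inner f g = L2_inner (f * circle_z) (circle_cnj k)"
    unfolding k(2) by (simp add: L2_inner_mult_left[symmetric] mult.commute)
  also have "\<dots> = L2_inner (circle_zpow (Suc 0)) (circle_cnj (f * k))"
    by (simp add: L2_inner_mult_left circle_zpow_Suc_0 circle_cnj_mult)
  also have "\<dots> = 0" by (rule L2_inner_zpow_boundary_product[OF FG])
  finally show ?thesis .
qed

text \<open>
  The Riesz projection of \<open>f\<close>.
\<close>

lemma H2_function_with_same_coefficients:
  assumes "f \<in> L2"
  shows "\<exists>p\<in>H2. \<forall>n. L2_inner (f - p) (circle_zpow n) = 0"
proof -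
  have "\<exists>p. (square_integrable p \<and> (\<exists>F\<in>hardy_disk. L2_dilation_limit F p)) \<and>
      (\<forall>n. L2_inner (f - p) (circle_zpow n) = 0)"
    using assms unfolding L2_def mem_Collect_eq
  proof transfer
    fix f :: "complex \<Rightarrow> complex"
    assume "circle_eq f f" "integrable circle_measure (\<lambda>z. (cmod (f z))\<^sup>2)"
    then have f: "sq_int circle_measure f" by (simp add: circle_eq_sq_int)
    obtain F h where F: "F \<in> hardy_disk" and h: "sq_int circle_measure h"
      and lim: "((\<lambda>r. sq_norm (\<lambda>z. F (of_real r * z) - h z)) \<longlongrightarrow> 0) (at_left 1)"
      and coeff: "\<And>n. fcoeff h n = fcoeff f n"
      by (rule hardy_function_of_coefficients[OF summable_fcoeff[OF f]]) blast
    have c: "(\<integral>z. (f z - h z) * cnj (z ^ n) \<partial>circle_measure) = 0" for n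
      using fcoeff_diff[OF f h, of n] coeff[of n] by (simp add: fcoeff_def)
    have hol: "F holomorphic_on ball 0 1" using F by (simp add: hardy_disk_def)
    show "\<exists>p\<in>{p. circle_eq p p}. (integrable circle_measure (\<lambda>z. (cmod (p z))\<^sup>2) \<and>
        (\<exists>F\<in>hardy_disk. F holomorphic_on ball 0 1 \<and>
          ((\<lambda>r. sq_norm (\<lambda>z. F (of_real r * z) - p z)) \<longlongrightarrow> 0) (at_left 1))) \<and>
        (\<forall>n. (\<integral>z. (f z - p z) * cnj (z ^ n) \<partial>circle_measure) = 0)"
      using F h lim c hol sq_int_measurable[OF h] sq_int_integrable[OF h]
      by (intro bexI[of _ h]) (auto simp: circle_eq_refl)
  qed
  then show ?thesis by (auto simp: H2_def boundary_function_def L2_def)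
qed

text \<open>
  Subtracting the Riesz projection from \<open>f\<close> leaves a function \<open>q\<close>
  with only negative Fourier coefficients; conjugation and a shift by one index turn it into
  an element of \<open>H2\<close>.
\<close>

lemma L2_eq_H2_plus_H2_minus:
  assumes f: "f \<in> L2"
  obtains p q where "p \<in> H2" "q \<in> H2_minus" "f = p + q"
proof -
  obtain p where p: "p \<in> H2" "\<And>n. L2_inner (f - p) (circle_zpow n) = 0"
    using H2_function_with_same_coefficients[OF f] by blast
  define q where "q = f - p"
  define k where "k = circle_cnj circle_z * circle_cnj q"
  have q: "q \<in> L2" unfolding q_def by (intro L2_diff f H2_L2 p)
  have "L2_inner (circle_zpow (Suc n)) (circle_cnj k) = 0" for n
  proof -
    have "L2_inner (circle_zpow (Suc n)) (circle_cnj k) = L2_inner (circle_cnj circle_z * (circle_z * circle_zpow n)) q"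
      by (simp add: k_def circle_cnj_mult circle_zpow_Suc L2_inner_mult_left)
    also have "\<dots> = L2_inner (circle_zpow n) q"
      by (simp add: unimodular_cancel[OF unimodular_z])
    finally show ?thesis using p(2)[of n] by (simp add: q_def L2_inner_eq_0_commute)
  qed
  then have "k \<in> H2"
    unfolding H2_iff k_def by (auto intro!: L2_unimodular_mult unimodular_cnj unimodular_z L2_cnj q)
  moreover have "q = circle_cnj circle_z * circle_cnj k"
    by (simp add: k_def circle_cnj_mult unimodular_cancel[OF unimodular_z])
  ultimately show ?thesis
    using p(1) by (intro that[of p q]) (auto simp: H2_minus_def q_def algebra_simps)
qed

lemma H2_minus_orthogonal_H2: "f \<in> H2_minus \<Longrightarrow> g \<in> H2 \<Longrightarrow> L2_inner f g = 0"
  using H2_orthogonal_H2_minus L2_inner_eq_0_commute by blast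

section \<open>The complement of the model space\<close>

lemma inner_function_unimodular: "inner_function \<theta> \<Longrightarrow> unimodular \<theta>"
  by (simp add: inner_function_def)

lemma model_space_L2: "f \<in> model_space \<theta> \<Longrightarrow> f \<in> L2"
  by (auto simp: model_space_def ominus_def H2_L2)

lemma model_perp_L2: "f \<in> model_perp \<theta> \<Longrightarrow> f \<in> L2"
  by (auto simp: model_perp_def ominus_def)

lemma model_perp_diff: "f \<in> model_perp \<theta> \<Longrightarrow> g \<in> model_perp \<theta> \<Longrightarrow> f - g \<in> model_perp \<theta>"
  by (auto simp: model_perp_def ominus_def L2_diff L2_inner_diff_left model_space_L2)

lemma model_perp_zero: "0 \<in> model_perp \<theta>"
  by (simp add: model_perp_def ominus_def L2_zero)

lemma H2_minus_plus_theta_H2_in_model_perp: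
  assumes \<theta>: "inner_function \<theta>" and "q \<in> H2_minus" "k \<in> H2"
  shows "q + \<theta> * k \<in> model_perp \<theta>"
  unfolding model_perp_def ominus_def
proof (intro CollectI conjI ballI)
  have L: "q \<in> L2" "\<theta> * k \<in> L2"
    using assms H2_minus_L2 H2_L2 H2_mult_inner by auto
  then show "q + \<theta> * k \<in> L2" by (rule L2_add)
  fix x assume x: "x \<in> model_space \<theta>"
  then have "x \<in> H2" "L2_inner x (\<theta> * k) = 0"
    using assms by (auto simp: model_space_def ominus_def)
  then show "L2_inner (q + \<theta> * k) x = 0"
    using assms L by (simp add: L2_inner_add_left H2_L2 H2_minus_orthogonal_H2 L2_inner_eq_0_commute[of "\<theta> * k"])
qed

text \<open>
  Split \<open>f = p + q\<close> along \<open>H2\<close> and \<open>H2_minus\<close>, and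
  then split \<open>circle_cnj \<theta> * p = k + l\<close> in the same way. The remaining
  part \<open>\<theta> * l = p - \<theta> * k\<close> lies in \<open>H2\<close>, and it is
  orthogonal to \<open>\<theta> H2\<close> since \<open>l\<close> is orthogonal to
  \<open>H2\<close> and multiplication by \<open>\<theta>\<close> is isometric.
\<close>

lemma L2_model_decomposition:
  assumes \<theta>: "inner_function \<theta>" and f: "f \<in> L2"
  obtains q k x where "q \<in> H2_minus" "k \<in> H2" "x \<in> model_space \<theta>" "f = q + \<theta> * k + x"
proof -
  note u = inner_function_unimodular[OF \<theta>]
  obtain p q where p: "p \<in> H2" and q: "q \<in> H2_minus" and f_eq: "f = p + q"
    by (rule L2_eq_H2_plus_H2_minus[OF f])
  have "circle_cnj \<theta> * p \<in> L2"
    by (intro L2_unimodular_mult unimodular_cnj u H2_L2 p)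
  then obtain k l where k: "k \<in> H2" and l: "l \<in> H2_minus" and kl: "circle_cnj \<theta> * p = k + l"
    by (rule L2_eq_H2_plus_H2_minus)
  have "p = \<theta> * (circle_cnj \<theta> * p)"
    using unimodular_cancel[OF unimodular_cnj[OF u]] by simp
  then have p_eq: "p = \<theta> * k + \<theta> * l" by (simp add: kl distrib_left)
  have "\<theta> * l \<in> model_space \<theta>"
    unfolding model_space_def ominus_def
  proof (intro CollectI conjI ballI)
    have "\<theta> * l = p - \<theta> * k" using p_eq by simp
    then show "\<theta> * l \<in> H2" by (simp add: H2_diff p H2_mult_inner[OF \<theta> k])
    fix y assume "y \<in> (\<lambda>h. \<theta> * h) ` H2"
    then obtain h where h: "h \<in> H2" "y = \<theta> * h" by auto
    have "L2_inner (\<theta> * l) y = L2_inner l h"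
      by (simp add: h L2_inner_mult_left unimodular_cancel[OF u])
    then show "L2_inner (\<theta> * l) y = 0" using l h by (simp add: H2_minus_orthogonal_H2)
  qed
  then show ?thesis
    by (intro that[OF q k]) (auto simp: f_eq p_eq algebra_simps)
qed

text \<open>
  The component in the model space of a vector orthogonal to the model space is orthogonal
  to itself.
\<close>

lemma model_perp_decomposition:
  assumes \<theta>: "inner_function \<theta>" and f: "f \<in> model_perp \<theta>"
  obtains q k where "q \<in> H2_minus" "k \<in> H2" "f = q + \<theta> * k"
proof -
  obtain q k x where *: "q \<in> H2_minus" "k \<in> H2" "x \<in> model_space \<theta>" "f = q + \<theta> * k + x"
    using L2_model_decomposition[OF \<theta> model_perp_L2[OF f]] .
  have "f - (q + \<theta> * k) \<in> model_perp \<theta>"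
    by (intro model_perp_diff f H2_minus_plus_theta_H2_in_model_perp \<theta> *)
  then have "x \<in> model_perp \<theta>" by (simp add: *(4))
  then have "L2_inner x x = 0" using *(3) by (simp add: model_perp_def ominus_def)
  then have "x = 0" using model_space_L2[OF *(3)] by (rule L2_inner_self_eq_0[rotated])
  with * show ?thesis by (intro that[of q k]) auto
qed

section \<open>Kernel and adjoint of dual truncated Toeplitz operators\<close>

text \<open>
  The first two summands of \<open>L2_model_decomposition\<close> form the projection. A
  second candidate would differ from it by a vector of \<open>model_perp \<theta>\<close>
  that is orthogonal to \<open>model_perp \<theta>\<close>, so the definite description in
  \<open>orth_proj\<close> denotes it.
\<close>

lemma orth_proj_model_perp:
  assumes \<theta>: "inner_function \<theta>" and g: "g \<in> L2"
  shows "orth_proj (model_perp \<theta>) g \<in> model_perp \<theta>"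
    and "h \<in> model_perp \<theta> \<Longrightarrow> L2_inner (g - orth_proj (model_perp \<theta>) g) h = 0"
    and "p \<in> model_perp \<theta> \<Longrightarrow> (\<And>h. h \<in> model_perp \<theta> \<Longrightarrow> L2_inner (g - p) h = 0) \<Longrightarrow>
      orth_proj (model_perp \<theta>) g = p"
proof -
  let ?P = "\<lambda>p. p \<in> model_perp \<theta> \<and> (\<forall>h\<in>model_perp \<theta>. L2_inner (g - p) h = 0)"
  obtain q k x where *: "q \<in> H2_minus" "k \<in> H2" "x \<in> model_space \<theta>" "g = q + \<theta> * k + x"
    using L2_model_decomposition[OF \<theta> g] .
  have "?P (q + \<theta> * k)"
  proof (intro conjI ballI)
    show "q + \<theta> * k \<in> model_perp \<theta>"
      by (intro H2_minus_plus_theta_H2_in_model_perp \<theta> *)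
    fix h assume "h \<in> model_perp \<theta>"
    then have "L2_inner h x = 0" using *(3) by (simp add: model_perp_def ominus_def)
    then show "L2_inner (g - (q + \<theta> * k)) h = 0"
      by (simp add: *(4) L2_inner_eq_0_commute)
  qed
  moreover have uniq: "p = p'" if "?P p" "?P p'" for p p'
  proof -
    have d: "p - p' \<in> model_perp \<theta>" using that by (intro model_perp_diff) auto
    have L: "g - p' \<in> L2" "g - p \<in> L2" using that g by (auto intro!: L2_diff dest: model_perp_L2)
    have "L2_inner ((g - p') - (g - p)) (p - p') = 0"
      using that d L by (subst L2_inner_diff_left) (auto intro: model_perp_L2)
    then have "L2_inner (p - p') (p - p') = 0" by simp
    then have "p - p' = 0" by (rule L2_inner_self_eq_0[OF model_perp_L2[OF d]])
    then show ?thesis by simp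
  qed
  ultimately have "?P (orth_proj (model_perp \<theta>) g)"
    unfolding orth_proj_def by (intro theI[where P = ?P]) auto
  then show "orth_proj (model_perp \<theta>) g \<in> model_perp \<theta>"
    and "h \<in> model_perp \<theta> \<Longrightarrow> L2_inner (g - orth_proj (model_perp \<theta>) g) h = 0"
    and "p \<in> model_perp \<theta> \<Longrightarrow> (\<And>h. h \<in> model_perp \<theta> \<Longrightarrow> L2_inner (g - p) h = 0) \<Longrightarrow>
      orth_proj (model_perp \<theta>) g = p"
    using uniq by blast+
qed

lemma dual_toeplitz_in_model_perp:
  assumes "inner_function \<theta>" "\<phi> \<in> Linf" "f \<in> model_perp \<theta>"
  shows "dual_toeplitz \<theta> \<phi> f \<in> model_perp \<theta>"
  unfolding dual_toeplitz_def
  by (intro orth_proj_model_perp(1) assms L2_Linf_mult model_perp_L2[OF assms(3)])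

lemma L2_inner_dual_toeplitz:
  assumes \<theta>: "inner_function \<theta>" and \<phi>: "\<phi> \<in> Linf" and f: "f \<in> model_perp \<theta>" and g: "g \<in> model_perp \<theta>"
  shows "L2_inner (dual_toeplitz \<theta> \<phi> f) g = L2_inner (\<phi> * f) g"
proof -
  have L: "\<phi> * f \<in> L2" by (intro L2_Linf_mult \<phi> model_perp_L2[OF f])
  have "L2_inner (\<phi> * f - dual_toeplitz \<theta> \<phi> f) g = 0"
    unfolding dual_toeplitz_def by (rule orth_proj_model_perp(2)[OF \<theta> L g])
  then show ?thesis
    using L dual_toeplitz_in_model_perp[OF \<theta> \<phi> f] g
    by (simp add: L2_inner_diff_left model_perp_L2)
qed

lemma ker_dual_toeplitz:
  assumes \<theta>: "inner_function \<theta>" and \<phi>: "\<phi> \<in> Linf"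
  shows "ker_on (model_perp \<theta>) (dual_toeplitz \<theta> \<phi>)
    = {f \<in> model_perp \<theta>. \<forall>h\<in>model_perp \<theta>. L2_inner (\<phi> * f) h = 0}"
proof -
  have "dual_toeplitz \<theta> \<phi> f = 0 \<longleftrightarrow> (\<forall>h\<in>model_perp \<theta>. L2_inner (\<phi> * f) h = 0)"
    if f: "f \<in> model_perp \<theta>" for f
  proof
    assume "dual_toeplitz \<theta> \<phi> f = 0"
    then show "\<forall>h\<in>model_perp \<theta>. L2_inner (\<phi> * f) h = 0"
      using L2_inner_dual_toeplitz[OF \<theta> \<phi> f] by (metis L2_inner_zero_left)
  next
    assume "\<forall>h\<in>model_perp \<theta>. L2_inner (\<phi> * f) h = 0"
    then show "dual_toeplitz \<theta> \<phi> f = 0"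
      unfolding dual_toeplitz_def
      by (intro orth_proj_model_perp(3) \<theta> L2_Linf_mult \<phi> model_perp_L2[OF f] model_perp_zero) auto
  qed
  then show ?thesis by (auto simp: ker_on_def)
qed

lemma adjoint_dual_toeplitz:
  assumes \<theta>: "inner_function \<theta>" and \<phi>: "\<phi> \<in> Linf" and g: "g \<in> model_perp \<theta>"
  shows "adjoint_on (model_perp \<theta>) (dual_toeplitz \<theta> \<phi>) g = dual_toeplitz \<theta> (circle_cnj \<phi>) g"
  unfolding adjoint_on_def
proof (rule the_equality)
  let ?h = "dual_toeplitz \<theta> (circle_cnj \<phi>) g"
  have "L2_inner (dual_toeplitz \<theta> \<phi> f) g = L2_inner f ?h" if f: "f \<in> model_perp \<theta>" for f
  proof -
    have "L2_inner (dual_toeplitz \<theta> \<phi> f) g = L2_inner f (circle_cnj \<phi> * g)"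
      by (simp add: L2_inner_dual_toeplitz \<theta> \<phi> f g L2_inner_mult_left)
    also have "\<dots> = cnj (L2_inner (circle_cnj \<phi> * g) f)" by (rule L2_inner_commute)
    also have "\<dots> = cnj (L2_inner ?h f)"
      by (simp add: L2_inner_dual_toeplitz \<theta> Linf_cnj \<phi> f g)
    also have "\<dots> = L2_inner f ?h" by (rule L2_inner_commute[symmetric])
    finally show ?thesis .
  qed
  then show *: "?h \<in> model_perp \<theta> \<and> (\<forall>f\<in>model_perp \<theta>. L2_inner (dual_toeplitz \<theta> \<phi> f) g = L2_inner f ?h)"
    by (simp add: dual_toeplitz_in_model_perp \<theta> Linf_cnj \<phi> g)
  fix h assume h: "h \<in> model_perp \<theta> \<and> (\<forall>f\<in>model_perp \<theta>. L2_inner (dual_toeplitz \<theta> \<phi> f) g = L2_inner f h)"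
  have d: "h - ?h \<in> model_perp \<theta>" using h * by (intro model_perp_diff) auto
  have "L2_inner (h - ?h) (h - ?h) = L2_inner (h - ?h) h - L2_inner (h - ?h) ?h"
    using h * d by (intro L2_inner_diff_right) (auto intro: model_perp_L2)
  also have "\<dots> = 0" using h * d by (metis diff_self)
  finally have "h - ?h = 0" by (rule L2_inner_self_eq_0[OF model_perp_L2[OF d]])
  then show "h = ?h" by simp
qed

lemma ker_adjoint_dual_toeplitz:
  assumes "inner_function \<theta>" "\<phi> \<in> Linf"
  shows "ker_on (model_perp \<theta>) (adjoint_on (model_perp \<theta>) (dual_toeplitz \<theta> \<phi>))
    = ker_on (model_perp \<theta>) (dual_toeplitz \<theta> (circle_cnj \<phi>))"
  using adjoint_dual_toeplitz[OF assms] by (auto simp: ker_on_def)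

section \<open>The conjugation\<close>

lemma C_conj_eq: "C_conj \<theta> f = (\<theta> * circle_cnj circle_z) * circle_cnj f"
  by (simp add: C_conj_def)

lemma C_conj_unimodular: "unimodular \<theta> \<Longrightarrow> unimodular (\<theta> * circle_cnj circle_z)"
  by (intro unimodular_mult unimodular_cnj unimodular_z)

lemma C_conj_involution:
  assumes "unimodular \<theta>"
  shows "C_conj \<theta> (C_conj \<theta> f) = f"
  unfolding C_conj_eq circle_cnj_mult[of "\<theta> * circle_cnj circle_z"]
  using unimodular_cancel[OF unimodular_cnj[OF C_conj_unimodular[OF assms]]] by simp

lemma L2_inner_C_conj:
  assumes "unimodular \<theta>"
  shows "L2_inner (C_conj \<theta> f) (C_conj \<theta> g) = L2_inner g f"
  unfolding C_conj_eq
  by (simp add: L2_inner_mult_left[of "\<theta> * circle_cnj circle_z"] unimodular_cancel[OF C_conj_unimodular[OF assms]] L2_inner_cnj)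

text \<open>
  The identity behind the whole theorem: the right-hand side is the formula that defines
  \<open>N_D\<close>.
\<close>

lemma C_conj_on_decomposition:
  assumes "unimodular \<theta>"
  shows "C_conj \<theta> (q + \<theta> * k) = circle_cnj (circle_z * k) + \<theta> * circle_cnj (circle_z * q)"
proof -
  have "C_conj \<theta> (\<theta> * k) = circle_cnj \<theta> * (\<theta> * (circle_cnj circle_z * circle_cnj k))"
    by (simp add: C_conj_def circle_cnj_mult mult_ac)
  also have "\<dots> = circle_cnj (circle_z * k)"
    by (simp add: unimodular_cancel[OF assms] circle_cnj_mult)
  finally show ?thesis
    by (simp add: C_conj_def circle_cnj_mult circle_cnj_add distrib_left mult.assoc add.commute)
qed

text \<open>
  The conjugation exchanges the summands: it maps \<open>H2_minus\<close> to \<open>\<theta>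
  H2\<close> and \<open>\<theta> H2\<close> to \<open>H2_minus\<close>.
\<close>

lemma C_conj_model_perp:
  assumes \<theta>: "inner_function \<theta>" and f: "f \<in> model_perp \<theta>"
  shows "C_conj \<theta> f \<in> model_perp \<theta>"
proof -
  obtain q k where qk: "q \<in> H2_minus" "k \<in> H2" "f = q + \<theta> * k"
    by (rule model_perp_decomposition[OF \<theta> f])
  obtain h where h: "h \<in> H2" "q = circle_cnj circle_z * circle_cnj h"
    using qk(1) by (auto simp: H2_minus_def)
  have "circle_cnj (circle_z * q) = h"
    by (simp add: h(2) circle_cnj_mult unimodular_cancel[OF unimodular_z])
  moreover have "circle_cnj (circle_z * k) \<in> H2_minus"
    using qk(2) by (auto simp: H2_minus_def circle_cnj_mult)
  ultimately show ?thesis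
    using h(1) by (simp add: qk(3) C_conj_on_decomposition inner_function_unimodular \<theta> H2_minus_plus_theta_H2_in_model_perp)
qed

text \<open>
  Since \<open>C_conj \<theta> (\<phi> * f) = circle_cnj \<phi> * C_conj \<theta> f\<close>
  and the antiunitary \<open>C_conj \<theta>\<close> preserves the complement
  \<open>M\<close> of the model space, orthogonality of \<open>\<phi> * f\<close> to
  \<open>M\<close> is carried over to the image.
\<close>

lemma C_conj_ker:
  assumes \<theta>: "inner_function \<theta>" and \<phi>: "\<phi> \<in> Linf"
    and f: "f \<in> ker_on (model_perp \<theta>) (dual_toeplitz \<theta> \<phi>)"
  shows "C_conj \<theta> f \<in> ker_on (model_perp \<theta>) (dual_toeplitz \<theta> (circle_cnj \<phi>))"
proof -
  note u = inner_function_unimodular[OF \<theta>]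
  have f': "f \<in> model_perp \<theta>" "\<And>h. h \<in> model_perp \<theta> \<Longrightarrow> L2_inner (\<phi> * f) h = 0"
    using f by (auto simp: ker_dual_toeplitz[OF \<theta> \<phi>])
  have "L2_inner (circle_cnj \<phi> * C_conj \<theta> f) h = 0" if h: "h \<in> model_perp \<theta>" for h
  proof -
    have "circle_cnj \<phi> * C_conj \<theta> f = C_conj \<theta> (\<phi> * f)"
      by (simp add: C_conj_def circle_cnj_mult mult_ac)
    then have "L2_inner (circle_cnj \<phi> * C_conj \<theta> f) h = L2_inner (C_conj \<theta> (\<phi> * f)) (C_conj \<theta> (C_conj \<theta> h))"
      by (simp add: C_conj_involution[OF u])
    also have "\<dots> = L2_inner (C_conj \<theta> h) (\<phi> * f)" by (rule L2_inner_C_conj[OF u])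
    also have "\<dots> = 0" using f'(2)[OF C_conj_model_perp[OF \<theta> h]] by (simp add: L2_inner_eq_0_commute)
    finally show ?thesis .
  qed
  then show ?thesis
    by (simp add: ker_dual_toeplitz[OF \<theta> Linf_cnj[OF \<phi>]] C_conj_model_perp[OF \<theta> f'(1)])
qed

text \<open>
  By \<open>C_conj_on_decomposition\<close> the value of the defining formula is the same
  for every decomposition of \<open>f\<close>.
\<close>

lemma N_D_eq_C_conj:
  assumes \<theta>: "inner_function \<theta>" and f: "f \<in> model_perp \<theta>"
  shows "N_D \<theta> f = C_conj \<theta> f"
  unfolding N_D_def
proof (rule the_equality)
  obtain q k where "q \<in> H2_minus" "k \<in> H2" "f = q + \<theta> * k"
    by (rule model_perp_decomposition[OF \<theta> f])
  then show "\<exists>q\<in>H2_minus. \<exists>k\<in>H2. f = q + \<theta> * k \<and>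
      C_conj \<theta> f = circle_cnj (circle_z * k) + \<theta> * circle_cnj (circle_z * q)"
    using C_conj_on_decomposition[OF inner_function_unimodular[OF \<theta>]] by blast
qed (auto simp: C_conj_on_decomposition[OF inner_function_unimodular[OF \<theta>]])

theorem theorem6p3:
  fixes \<theta> \<phi> :: circle_fun
  assumes "inner_function \<theta>" and "\<phi> \<in> Linf"
  shows "(\<forall>f\<in>ker_on (model_perp \<theta>) (dual_toeplitz \<theta> \<phi>).
            \<exists>f_minus\<in>H2_minus. \<exists>f_plus\<in>H2. f = f_minus + \<theta> * f_plus) \<and>
         (\<forall>f_minus\<in>H2_minus. \<forall>f_plus\<in>H2.
            f_minus + \<theta> * f_plus \<in> ker_on (model_perp \<theta>) (dual_toeplitz \<theta> \<phi>) \<longrightarrow>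
            N_D \<theta> (f_minus + \<theta> * f_plus) =
              circle_cnj (circle_z * f_plus) + \<theta> * circle_cnj (circle_z * f_minus)) \<and>
         conj_linear_iso (N_D \<theta>)
            (ker_on (model_perp \<theta>) (dual_toeplitz \<theta> \<phi>))
            (ker_on (model_perp \<theta>) (adjoint_on (model_perp \<theta>) (dual_toeplitz \<theta> \<phi>))) \<and>
         ker_on (model_perp \<theta>) (adjoint_on (model_perp \<theta>) (dual_toeplitz \<theta> \<phi>)) =
            C_conj \<theta> ` ker_on (model_perp \<theta>) (dual_toeplitz \<theta> \<phi>)"
proof -
  note \<theta> = assms(1) and \<phi> = assms(2)
  note u = inner_function_unimodular[OF \<theta>]
  let ?K = "ker_on (model_perp \<theta>) (dual_toeplitz \<theta> \<phi>)"
  let ?K' = "ker_on (model_perp \<theta>) (dual_toeplitz \<theta> (circle_cnj \<phi>))"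
  have perp: "f \<in> model_perp \<theta>" if "f \<in> ?K" for f using that by (simp add: ker_on_def)
  have N: "N_D \<theta> f = C_conj \<theta> f" if "f \<in> ?K" for f by (rule N_D_eq_C_conj[OF \<theta> perp[OF that]])
  have to_K: "C_conj \<theta> f \<in> ?K'" if "f \<in> ?K" for f by (rule C_conj_ker[OF \<theta> \<phi> that])
  have from_K: "C_conj \<theta> f \<in> ?K" if "f \<in> ?K'" for f
    using C_conj_ker[OF \<theta> Linf_cnj[OF \<phi>] that] by simp
  have image: "?K' = C_conj \<theta> ` ?K"
    using to_K from_K C_conj_involution[OF u] by (metis (no_types, lifting) image_iff subsetI subset_antisym image_subsetI)
  have bij: "bij_betw (N_D \<theta>) ?K ?K'"
    by (rule bij_betw_byWitness[where f' = "C_conj \<theta>"])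
      (use N to_K from_K C_conj_involution[OF u] in auto)
  have add: "f + g \<in> model_perp \<theta>" if "f \<in> ?K" "g \<in> ?K" for f g
    using perp[OF that(1)] perp[OF that(2)]
    by (auto simp: model_perp_def ominus_def L2_add L2_inner_add_left model_space_L2)
  have scale: "circle_const c * f \<in> model_perp \<theta>" if "f \<in> ?K" for f c
    using perp[OF that]
    by (auto simp: model_perp_def ominus_def L2_const_mult L2_inner_const_left)
  have norm: "L2_norm (N_D \<theta> f) = L2_norm f" if "f \<in> ?K" for f
    by (simp add: N[OF that] C_conj_eq L2_norm_unimodular_mult[OF C_conj_unimodular[OF u]] L2_norm_cnj)
  have iso: "conj_linear_iso (N_D \<theta>) ?K ?K'"
    unfolding conj_linear_iso_def
  proof (intro conjI ballI allI)
    show "bij_betw (N_D \<theta>) ?K ?K'" by (rule bij)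
    show "N_D \<theta> (f + g) = N_D \<theta> f + N_D \<theta> g" if "f \<in> ?K" "g \<in> ?K" for f g
      using that by (simp add: N N_D_eq_C_conj[OF \<theta> add] C_conj_eq circle_cnj_add distrib_left)
    show "N_D \<theta> (circle_const c * f) = circle_const (cnj c) * N_D \<theta> f" if "f \<in> ?K" for f c
      using that by (simp add: N N_D_eq_C_conj[OF \<theta> scale] C_conj_eq circle_cnj_mult circle_cnj_const mult.left_commute)
    show "\<exists>C. \<forall>f\<in>?K. L2_norm (N_D \<theta> f) \<le> C * L2_norm f"
      using norm by (intro exI[of _ 1]) simp
    show "\<exists>C. \<forall>f\<in>?K. L2_norm f \<le> C * L2_norm (N_D \<theta> f)"
      using norm by (intro exI[of _ 1]) simp
  qed
  show ?thesis
    unfolding ker_adjoint_dual_toeplitz[OF \<theta> \<phi>]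
  proof (intro conjI ballI impI)
    show "\<exists>f_minus\<in>H2_minus. \<exists>f_plus\<in>H2. f = f_minus + \<theta> * f_plus" if "f \<in> ?K" for f
      using model_perp_decomposition[OF \<theta> perp[OF that]] by metis
    show "N_D \<theta> (f_minus + \<theta> * f_plus) =
        circle_cnj (circle_z * f_plus) + \<theta> * circle_cnj (circle_z * f_minus)"
      if "f_minus + \<theta> * f_plus \<in> ?K" for f_minus f_plus
      unfolding N[OF that] by (rule C_conj_on_decomposition[OF u])
  qed (rule iso, rule image)
qed

end
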